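(* Let $m$ be an even integer with $m\ge 258$, and let $G$ be a triangle-free, non-bipartite graph with exactly $m$ edges. Let $\lambda(G)$ denote the spectral radius of the adjacency matrix of $G$. (a) If $m=3t$ for some positive integer $t$, then $\lambda(G)\le \lambda(Y_m)$, with equality if and only if $G=Y_m$. (b) If $m=3t+1$ for some positive integer $t$, then $\lambda(G)\le \lambda(T_m)$, with equality if and only if $G=T_m$. (c) If $m=3t+2$ for some positive integer $t$, then $\lambda(G)\le \lambda(L_m)$, with equality if and only if $G=L_m$.
   Context: Graphs are simple; isolated vertices are ignored when graphs are specified by their number of edges. $\lambda(G)$ is the largest eigenvalue (spectral radius) of the adjacency matrix of $G$. For integers $s,k$, $SK_{s,k}$ denotes the graph obtained from the complete bipartite graph $K_{s,k}$ by subdividing one edge (replacing it by a path of length 2). For even $m$: $L_m$ is the graph obtained from $SK_{2,\frac{m-2}{2}}$ by attaching a pendant edge (a new vertex joined by one edge) to a vertex of maximum degree; equivalently, take a 5-cycle $u_1u_2u_3u_4u_5$, add $\frac{m-6}{2}$ new vertices each adjacent to exactly $u_1$ and $u_3$, and add one new vertex adjacent only to $u_1$. When $\frac{m-3}{3}$ is a positive integer, $Y_m$ is the graph obtained from the 5-cycle $C_5$ by replacing one vertex by an independent set $I$ of $\frac{m-3}{3}$ vertices (each adjacent to both neighbours of the replaced vertex), then adding one new vertex adjacent to all vertices of $I$. When $\frac{m-4}{3}$ is a positive integer, $T_m$ is the graph obtained from $C_5$ by replacing two adjacent vertices by independent sets of sizes $\frac{m-4}{3}$ and $2$ respectively (blow-up: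 each vertex of a set is adjacent to everything the replaced vertex was adjacent to, with the two sets forming a complete bipartite graph between them). *)

theory Defs
  imports Complex_Main
begin

text \<open>A (simple) graph is given by its finite set of edges; each edge is a 2-element
  set of vertices. Isolated vertices are ignored: the vertex set is the union of the edges.\<close>

definition simple_graph :: "'a set set \<Rightarrow> bool" where
  "simple_graph G \<longleftrightarrow> finite G \<and> (\<forall>e\<in>G. card e = 2)"

definition verts :: "'a set set \<Rightarrow> 'a set" where
  "verts G = \<Union>G"

definition triangle_free :: "'a set set \<Rightarrow> bool" where
  "triangle_free G \<longleftrightarrow> \<not> (\<exists>a b c. {a,b} \<in> G \<and> {b,c} \<in> G \<and> {a,c} \<in> G)"

definition bipartite :: "'a set set \<Rightarrow> bool" where
  "bipartite G \<longleftrightarrow> (\<exists>col :: 'a \<Rightarrow> bool. \<forall>u v. {u,v} \<in> G \<longrightarrow> col u \<noteq> col v)"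

definition adj_eigenvalue :: "'a set set \<Rightarrow> real \<Rightarrow> bool" where
  "adj_eigenvalue G \<mu> \<longleftrightarrow>
     (\<exists>x :: 'a \<Rightarrow> real. (\<exists>v\<in>verts G. x v \<noteq> 0) \<and>
        (\<forall>v\<in>verts G. (\<Sum>u\<in>verts G. (if {u,v} \<in> G then 1 else 0) * x u) = \<mu> * x v))"

definition spec_rad :: "'a set set \<Rightarrow> real" where
  "spec_rad G = Max {\<mu>. adj_eigenvalue G \<mu>}"

definition graph_iso :: "'a set set \<Rightarrow> 'b set set \<Rightarrow> bool" where
  "graph_iso G H \<longleftrightarrow> (\<exists>f. bij_betw f (verts G) (verts H) \<and> (\<lambda>e. f ` e) ` G = H)"

text \<open>Y_m: C5 = u1u2u3u4u5 with u1 replaced by I of size k = (m-3)/3, plus a vertex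
  adjacent to all of I. Labels: u2=0, u3=1, u4=2, u5=3, new vertex 4, I = {5..4+k}.\<close>
definition Y_graph :: "nat \<Rightarrow> nat set set" where
  "Y_graph m = (let k = (m - 3) div 3 in
     {{0,1},{1,2},{2,3}} \<union> (\<Union>i\<in>{5..<5+k}. {{i,0},{i,3},{i,4}}))"

text \<open>T_m: C5 = u1..u5 with u1 replaced by A of size a = (m-4)/3 and u2 by B of size 2.
  Labels: u3=0, u4=1, u5=2, B = {3,4}, A = {5..4+a}.\<close>
definition T_graph :: "nat \<Rightarrow> nat set set" where
  "T_graph m = (let a = (m - 4) div 3 in
     {{3,0},{4,0},{0,1},{1,2}} \<union> (\<Union>i\<in>{5..<5+a}. {{i,2},{i,3},{i,4}}))"

text \<open>L_m: C5 = u1..u5 (labels 0..4), (m-6)/2 extra vertices adjacent to u1 and u3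
  (labels 6..), and a pendant vertex 5 adjacent to u1.\<close>
definition L_graph :: "nat \<Rightarrow> nat set set" where
  "L_graph m = (let k = (m - 6) div 2 in
     {{0,1},{1,2},{2,3},{3,4},{4,0},{0,5}} \<union> (\<Union>i\<in>{6..<6+k}. {{i,0},{i,2}}))"

end

theory Submission
  imports Defs "HOL-Analysis.Function_Topology"
begin

text \<open>Scale a nonnegative eigenvector \<open>x\<close> for \<open>\<rho> = spec_rad G\<close> so that its maximum is \<open>x u = 1\<close>, and let
  \<open>A\<close> be the neighbourhood of \<open>u\<close> and \<open>B\<close> the set of remaining vertices. Since \<open>A\<close> is independent,
  expanding \<open>\<rho>\<^sup>2 x u\<close> along walks of length two gives \<open>m - \<rho>\<^sup>2 = e(B) + (\<Sum>w\<in>B. d\<^sub>A(w) (1 - x w))\<close>. Rayleigh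
  quotients at the extremal graphs show that this deficiency may be assumed to be at most about 5/2.
  As \<open>G\<close> is not bipartite, \<open>B\<close> then spans exactly one edge \<open>ab\<close>, one end \<open>a\<close> has a single neighbour \<open>v\<close>
  in \<open>A\<close>, and every other vertex of \<open>B\<close> has large degree and weight almost 1. Hence \<open>G\<close> is \<open>K\<^bsub>s,n\<^esub>\<close> with few
  edges missing plus the path \<open>v - a - b\<close>. If \<open>j\<close> in \<open>A\<close> misses \<open>k\<^sub>j\<close> of the \<open>s\<close> vertices, the deficiency is
  about \<open>2 - 1/s + (\<Sum>j. k\<^sub>j (s - k\<^sub>j))/s\<close>, and together with the parity of \<open>m\<close> this leaves only \<open>s = 3\<close> with \<open>v\<close>
  the only vertex having a missing edge (giving \<open>Y\<^sub>m\<close> and \<open>T\<^sub>m\<close>) and \<open>s = 2\<close> with two missing edges (giving \<open>L\<^sub>m\<close>).\<close>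

section \<open>Adjacency form and spectral radius\<close>

definition nbrs :: "'a set set \<Rightarrow> 'a \<Rightarrow> 'a set" where
  "nbrs G v = {u. {u,v} \<in> G}"

lemma finite_verts: "simple_graph G \<Longrightarrow> finite (verts G)"
  unfolding simple_graph_def verts_def by (intro finite_Union) (auto intro!: card_ge_0_finite)

lemma nbrs_commute: "u \<in> nbrs G v \<longleftrightarrow> v \<in> nbrs G u"
  by (simp add: nbrs_def insert_commute)

lemma nbrs_subset_verts: "nbrs G v \<subseteq> verts G"
  by (auto simp: nbrs_def verts_def)

lemma finite_nbrs: "simple_graph G \<Longrightarrow> finite (nbrs G v)"
  by (rule finite_subset[OF nbrs_subset_verts finite_verts])

lemma not_nbrs_self: "simple_graph G \<Longrightarrow> v \<notin> nbrs G v"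
  by (auto simp: nbrs_def simple_graph_def)

lemma verts_iff_nbrs: "simple_graph G \<Longrightarrow> v \<in> verts G \<longleftrightarrow> nbrs G v \<noteq> {}"
proof
  assume G: "simple_graph G" and "v \<in> verts G"
  then obtain e where e: "e \<in> G" "v \<in> e" "card e = 2"
    unfolding verts_def simple_graph_def by blast
  then obtain a b where "e = {a,b}" unfolding card_2_iff by blast
  with e have "a \<in> nbrs G v \<or> b \<in> nbrs G v" by (auto simp: nbrs_def insert_commute)
  then show "nbrs G v \<noteq> {}" by blast
next
  assume "nbrs G v \<noteq> {}"
  then show "v \<in> verts G" unfolding nbrs_def verts_def by blast
qed

lemma adjacency_sum:
  fixes x :: "'a \<Rightarrow> real"
  assumes "simple_graph G"
  shows "(\<Sum>u\<in>verts G. (if {u,v} \<in> G then 1 else 0) * x u) = (\<Sum>u\<in>nbrs G v. x u)"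
proof -
  have "(\<Sum>u\<in>verts G. (if {u,v} \<in> G then 1 else 0) * x u) = (\<Sum>u\<in>verts G. if u \<in> nbrs G v then x u else 0)"
    by (intro sum.cong) (auto simp: nbrs_def)
  also have "\<dots> = (\<Sum>u\<in>verts G \<inter> nbrs G v. x u)"
    using assms by (simp add: sum.inter_restrict finite_verts)
  also have "verts G \<inter> nbrs G v = nbrs G v" using nbrs_subset_verts[of G v] by blast
  finally show ?thesis .
qed

lemma adj_eigenvalue_iff:
  assumes "simple_graph G"
  shows "adj_eigenvalue G \<mu> \<longleftrightarrow>
    (\<exists>x. (\<exists>v\<in>verts G. x v \<noteq> 0) \<and> (\<forall>v\<in>verts G. (\<Sum>u\<in>nbrs G v. x u) = \<mu> * x v))"
  unfolding adj_eigenvalue_def adjacency_sum[OF assms] ..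

section \<open>The quadratic form of the adjacency matrix\<close>

definition adj_form :: "'a set set \<Rightarrow> ('a \<Rightarrow> real) \<Rightarrow> ('a \<Rightarrow> real) \<Rightarrow> real" where
  "adj_form G x y = (\<Sum>v\<in>verts G. (\<Sum>u\<in>nbrs G v. x u) * y v)"

lemma adj_form_commute:
  assumes "simple_graph G"
  shows "adj_form G x y = adj_form G y x"
proof -
  have "adj_form G x y = (\<Sum>v\<in>verts G. \<Sum>u\<in>verts G. (if {u,v} \<in> G then 1 else 0) * x u * y v)"
    unfolding adj_form_def adjacency_sum[OF assms, symmetric] by (simp add: sum_distrib_right)
  also have "\<dots> = (\<Sum>u\<in>verts G. \<Sum>v\<in>verts G. (if {u,v} \<in> G then 1 else 0) * x u * y v)"
    by (rule sum.swap)
  also have "\<dots> = adj_form G y x"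
    unfolding adj_form_def adjacency_sum[OF assms, symmetric]
    by (intro sum.cong refl) (simp add: sum_distrib_left sum_distrib_right insert_commute mult_ac)
  finally show ?thesis .
qed

lemma adj_form_add_scaled:
  assumes "simple_graph G"
  shows "adj_form G (\<lambda>v. x v + t * y v) (\<lambda>v. x v + t * y v)
    = adj_form G x x + 2 * t * adj_form G x y + t^2 * adj_form G y y"
proof -
  have "adj_form G (\<lambda>v. x v + t * y v) (\<lambda>v. x v + t * y v)
    = adj_form G x x + t * adj_form G x y + t * adj_form G y x + t^2 * adj_form G y y"
    by (simp add: adj_form_def sum.distrib sum_distrib_left sum_distrib_right algebra_simps power2_eq_square)
  with adj_form_commute[OF assms, of y x] show ?thesis by simp
qed

lemma adj_form_eigen:
  assumes "\<And>v. v \<in> verts G \<Longrightarrow> (\<Sum>u\<in>nbrs G v. x u) = \<mu> * x v"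
  shows "adj_form G x y = \<mu> * (\<Sum>v\<in>verts G. x v * y v)"
  using assms by (simp add: adj_form_def sum_distrib_left mult.assoc)

text \<open>\<open>spec_rad\<close> is a \<open>Max\<close>, which is informative only once the set
  of eigenvalues is known to be finite. Symmetry of \<open>adj_form\<close> makes eigenvectors for
  distinct eigenvalues orthogonal, and there is room for at most \<open>card (verts G)\<close> of
  them.\<close>

lemma finite_eigenvalues:
  assumes G: "simple_graph G"
  shows "finite {\<mu>. adj_eigenvalue G \<mu>}"
proof (rule ccontr)
  assume "infinite {\<mu>. adj_eigenvalue G \<mu>}"
  then obtain S where S: "finite S" "card S = Suc (card (verts G))" "S \<subseteq> {\<mu>. adj_eigenvalue G \<mu>}"
    using infinite_arbitrarily_large by blast
  let ?V = "verts G"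
  have fV: "finite ?V" using finite_verts[OF G] .
  have "\<forall>\<mu>\<in>S. \<exists>x. (\<exists>v\<in>?V. x v \<noteq> 0) \<and> (\<forall>v\<in>?V. (\<Sum>u\<in>nbrs G v. x u) = \<mu> * x v)"
    using S(3) adj_eigenvalue_iff[OF G] by blast
  then obtain X where X: "\<And>\<mu>. \<mu> \<in> S \<Longrightarrow> \<exists>v\<in>?V. X \<mu> v \<noteq> 0"
    "\<And>\<mu> v. \<mu> \<in> S \<Longrightarrow> v \<in> ?V \<Longrightarrow> (\<Sum>u\<in>nbrs G v. X \<mu> u) = \<mu> * X \<mu> v"
    by metis
  define N where "N \<mu> = (\<Sum>v\<in>?V. X \<mu> v * X \<mu> v)" for \<mu>
  have Npos: "N \<mu> > 0" if mu: "\<mu> \<in> S" for \<mu>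
  proof -
    obtain v where "v \<in> ?V" "X \<mu> v \<noteq> 0" using X(1)[OF mu] by blast
    then show ?thesis unfolding N_def by (intro sum_pos2[OF fV, of v]) (auto simp: zero_less_mult_iff)
  qed
  have orth: "(\<Sum>v\<in>?V. X \<mu> v * X \<nu> v) = 0" if "\<mu> \<in> S" "\<nu> \<in> S" "\<mu> \<noteq> \<nu>" for \<mu> \<nu>
  proof -
    have "\<mu> * (\<Sum>v\<in>?V. X \<mu> v * X \<nu> v) = \<nu> * (\<Sum>v\<in>?V. X \<nu> v * X \<mu> v)"
      using adj_form_commute[OF G, of "X \<mu>" "X \<nu>"] adj_form_eigen[OF X(2)[OF that(1)], of "X \<nu>"]
        adj_form_eigen[OF X(2)[OF that(2)], of "X \<mu>"] by simp
    moreover have "(\<Sum>v\<in>?V. X \<nu> v * X \<mu> v) = (\<Sum>v\<in>?V. X \<mu> v * X \<nu> v)" by (simp add: mult.commute)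
    ultimately show ?thesis using that(3) by simp
  qed
  \<comment> \<open>Bessel's inequality for the unit vector at w; summed over w it bounds the number of
    orthogonal eigenvectors by the number of vertices.\<close>
  have bessel: "(\<Sum>\<mu>\<in>S. (X \<mu> w)^2 / N \<mu>) \<le> 1" if w: "w \<in> ?V" for w
  proof -
    define c where "c \<mu> = X \<mu> w / N \<mu>" for \<mu>
    define e where "e v = (if v = w then 1 else 0 :: real)" for v
    have e1: "(\<Sum>v\<in>?V. e v * f v) = f w" for f :: "'a \<Rightarrow> real"
    proof -
      have "(\<Sum>v\<in>?V. e v * f v) = (\<Sum>v\<in>?V. if w = v then f v else 0)"
        by (intro sum.cong) (auto simp: e_def)
      then show ?thesis using w fV by simp
    qed
    have "(\<Sum>v\<in>?V. (\<Sum>\<mu>\<in>S. c \<mu> * X \<mu> v) * (\<Sum>\<nu>\<in>S. c \<nu> * X \<nu> v))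
        = (\<Sum>v\<in>?V. \<Sum>\<mu>\<in>S. \<Sum>\<nu>\<in>S. c \<mu> * X \<mu> v * (c \<nu> * X \<nu> v))"
      by (simp add: sum_product)
    also have "\<dots> = (\<Sum>\<mu>\<in>S. \<Sum>v\<in>?V. \<Sum>\<nu>\<in>S. c \<mu> * X \<mu> v * (c \<nu> * X \<nu> v))"
      by (rule sum.swap)
    also have "\<dots> = (\<Sum>\<mu>\<in>S. \<Sum>\<nu>\<in>S. \<Sum>v\<in>?V. c \<mu> * X \<mu> v * (c \<nu> * X \<nu> v))"
      by (intro sum.cong refl sum.swap)
    also have "\<dots> = (\<Sum>\<mu>\<in>S. \<Sum>\<nu>\<in>S. c \<mu> * c \<nu> * (\<Sum>v\<in>?V. X \<mu> v * X \<nu> v))"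
      by (simp add: sum_distrib_left mult_ac)
    also have "\<dots> = (\<Sum>\<mu>\<in>S. \<Sum>\<nu>\<in>S. if \<mu> = \<nu> then c \<mu> * c \<mu> * N \<mu> else 0)"
      by (intro sum.cong refl) (auto simp: N_def orth)
    also have "\<dots> = (\<Sum>\<mu>\<in>S. c \<mu> * c \<mu> * N \<mu>)" using S(1) by simp
    also have "\<dots> = (\<Sum>\<mu>\<in>S. (X \<mu> w)^2 / N \<mu>)"
      using Npos by (intro sum.cong refl) (auto simp: c_def power2_eq_square field_simps)
    finally have sq: "(\<Sum>v\<in>?V. (\<Sum>\<mu>\<in>S. c \<mu> * X \<mu> v)^2) = (\<Sum>\<mu>\<in>S. (X \<mu> w)^2 / N \<mu>)"
      by (simp add: power2_eq_square)
    have expand: "(\<Sum>v\<in>?V. (e v - f v)^2)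
      = (\<Sum>v\<in>?V. e v * e v) - 2 * (\<Sum>v\<in>?V. e v * f v) + (\<Sum>v\<in>?V. (f v)^2)" for f :: "'a \<Rightarrow> real"
      by (simp add: algebra_simps sum.distrib sum_subtractf sum_distrib_left power2_eq_square)
    have "0 \<le> (\<Sum>v\<in>?V. (e v - (\<Sum>\<mu>\<in>S. c \<mu> * X \<mu> v))^2)" by (simp add: sum_nonneg)
    also have "\<dots> = (\<Sum>v\<in>?V. e v * e v) - 2 * (\<Sum>v\<in>?V. e v * (\<Sum>\<mu>\<in>S. c \<mu> * X \<mu> v))
        + (\<Sum>v\<in>?V. (\<Sum>\<mu>\<in>S. c \<mu> * X \<mu> v)^2)"
      by (rule expand)
    also have "\<dots> = 1 - 2 * (\<Sum>\<mu>\<in>S. c \<mu> * X \<mu> w) + (\<Sum>\<mu>\<in>S. (X \<mu> w)^2 / N \<mu>)"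
      unfolding e1 sq by (simp add: e_def)
    also have "(\<Sum>\<mu>\<in>S. c \<mu> * X \<mu> w) = (\<Sum>\<mu>\<in>S. (X \<mu> w)^2 / N \<mu>)"
      by (simp add: c_def power2_eq_square)
    finally show ?thesis by simp
  qed
  have "real (card S) = (\<Sum>\<mu>\<in>S. (\<Sum>w\<in>?V. (X \<mu> w)^2) / N \<mu>)"
  proof -
    have unit: "(\<Sum>w\<in>?V. (X \<mu> w)^2) / N \<mu> = 1" if "\<mu> \<in> S" for \<mu>
    proof -
      have "(\<Sum>w\<in>?V. (X \<mu> w)^2) = N \<mu>" by (simp add: N_def power2_eq_square)
      then show ?thesis using Npos[OF that] by simp
    qed
    have "(\<Sum>\<mu>\<in>S. (\<Sum>w\<in>?V. (X \<mu> w)^2) / N \<mu>) = (\<Sum>\<mu>\<in>S. 1)"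
      by (rule sum.cong[OF refl unit])
    then show ?thesis by simp
  qed
  also have "\<dots> = (\<Sum>\<mu>\<in>S. \<Sum>w\<in>?V. (X \<mu> w)^2 / N \<mu>)" by (simp add: sum_divide_distrib)
  also have "\<dots> = (\<Sum>w\<in>?V. \<Sum>\<mu>\<in>S. (X \<mu> w)^2 / N \<mu>)" by (rule sum.swap)
  also have "\<dots> \<le> (\<Sum>w\<in>?V. 1)" by (intro sum_mono bessel)
  finally show False using S(2) by simp
qed

text \<open>Maximise the form over nonnegative unit vectors, a compact set. Replacing
  \<open>y\<close> by its absolute values does not decrease the form, so the maximum
  \<open>\<mu>\<close> bounds it on all vectors; perturbing the maximiser in each coordinate then
  shows that it is an eigenvector.\<close>

lemma perron_exists:
  fixes G :: "'a set set"
  assumes G: "simple_graph G" and ne: "G \<noteq> {}"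
  obtains \<mu> x where "\<And>v. v \<in> verts G \<Longrightarrow> 0 \<le> x v" "\<exists>v\<in>verts G. x v \<noteq> 0"
    "\<And>v. v \<in> verts G \<Longrightarrow> (\<Sum>u\<in>nbrs G v. x u) = \<mu> * x v"
    "\<And>y. adj_form G y y \<le> \<mu> * (\<Sum>v\<in>verts G. (y v)^2)"
proof -
  let ?V = "verts G"
  have fV: "finite ?V" using finite_verts[OF G] .
  obtain e0 where "e0 \<in> G" using ne by blast
  moreover have "e0 \<noteq> {}" using G \<open>e0 \<in> G\<close> by (auto simp: simple_graph_def)
  ultimately obtain v0 where v0: "v0 \<in> ?V" by (auto simp: verts_def)
  \<comment> \<open>Vectors are functions on the whole, possibly infinite, vertex type. Pinning them
    to 0 off \<open>verts G\<close> makes \<open>P\<close> a product of compact sets.\<close>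
  define P where "P = (PiE UNIV (\<lambda>v. if v \<in> ?V then {0..1} else {0}) :: ('a \<Rightarrow> real) set)"
  have "compactin (product_topology (\<lambda>v. euclidean) UNIV) P"
    unfolding P_def compactin_PiE by (simp add: compact_Icc)
  then have cP: "compact P"
    by (metis compactin_euclidean_iff euclidean_product_topology)
  define K where "K = P \<inter> {x. (\<Sum>v\<in>?V. (x v)^2) = 1}"
  have contv: "continuous_on UNIV (\<lambda>x::'a \<Rightarrow> real. x v)" for v by simp
  have "closed {x::'a \<Rightarrow> real. (\<Sum>v\<in>?V. (x v)^2) = 1}"
    by (intro closed_Collect_eq continuous_intros contv)
  then have cK: "compact K" unfolding K_def by (rule compact_Int_closed[OF cP])
  have "(\<lambda>v. if v = v0 then 1 else 0) \<in> K"
    using v0 fV by (auto simp: K_def P_def if_distrib[of "\<lambda>z. z^2"] cong: if_cong)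
  then have Kne: "K \<noteq> {}" by blast
  have "continuous_on K (\<lambda>x. adj_form G x x)"
    unfolding adj_form_def by (intro continuous_intros continuous_on_subset[OF contv] subset_UNIV)
  then obtain x where x: "x \<in> K" "\<And>y. y \<in> K \<Longrightarrow> adj_form G y y \<le> adj_form G x x"
    using continuous_attains_sup[OF cK Kne] by blast
  define \<mu> where "\<mu> = adj_form G x x"
  have x0: "0 \<le> x v" if "v \<in> ?V" for v
    using x(1) that by (auto simp: K_def P_def PiE_def Pi_def split: if_splits dest!: spec[of _ v])
  have x1: "(\<Sum>v\<in>?V. (x v)^2) = 1" using x(1) by (simp add: K_def)
  have ray: "adj_form G y y \<le> \<mu> * (\<Sum>v\<in>?V. (y v)^2)" for y
  proof (cases "\<forall>v\<in>?V. y v = 0")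
    case True
    then show ?thesis by (simp add: adj_form_def)
  next
    case False
    define s where "s = sqrt (\<Sum>v\<in>?V. (y v)^2)"
    have s2: "s^2 = (\<Sum>v\<in>?V. (y v)^2)" unfolding s_def by (simp add: sum_nonneg)
    obtain v1 where "v1 \<in> ?V" "y v1 \<noteq> 0" using False by blast
    then have "(\<Sum>v\<in>?V. (y v)^2) > 0" by (intro sum_pos2[OF fV, of v1]) auto
    then have spos: "s > 0" by (simp add: s_def)
    define z where "z v = (if v \<in> ?V then \<bar>y v\<bar> / s else 0)" for v
    have zs: "(\<Sum>v\<in>?V. (z v)^2) = 1"
    proof -
      have "(\<Sum>v\<in>?V. (z v)^2) = (\<Sum>v\<in>?V. (y v)^2) / s^2"
        by (simp add: z_def power_divide sum_divide_distrib)
      then show ?thesis using spos unfolding s2[symmetric] by simp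
    qed
    have "z v \<le> 1" if "v \<in> ?V" for v
    proof -
      have "(z v)^2 \<le> (\<Sum>v\<in>?V. (z v)^2)" by (rule member_le_sum[OF that]) (auto simp: fV)
      then have "(z v)^2 \<le> 1^2" by (simp add: zs)
      then show ?thesis by (rule power2_le_imp_le) simp
    qed
    then have "z \<in> K" using spos zs by (auto simp: K_def P_def z_def)
    then have "adj_form G z z \<le> \<mu>" using x(2) by (simp add: \<mu>_def)
    moreover have "adj_form G z z = adj_form G (\<lambda>v. \<bar>y v\<bar>) (\<lambda>v. \<bar>y v\<bar>) / s^2"
    proof -
      have "(\<Sum>u\<in>nbrs G v. z u) = (\<Sum>u\<in>nbrs G v. \<bar>y u\<bar>) / s" for v
        unfolding sum_divide_distrib using nbrs_subset_verts[of G v] by (intro sum.cong) (auto simp: z_def)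
      then have "adj_form G z z = (\<Sum>v\<in>?V. (\<Sum>u\<in>nbrs G v. \<bar>y u\<bar>) / s * (\<bar>y v\<bar> / s))"
        unfolding adj_form_def by (intro sum.cong refl) (simp add: z_def)
      then show ?thesis
        by (simp add: adj_form_def power2_eq_square sum_divide_distrib[of _ "?V"])
    qed
    moreover have "adj_form G y y \<le> adj_form G (\<lambda>v. \<bar>y v\<bar>) (\<lambda>v. \<bar>y v\<bar>)"
      unfolding adj_form_def
    proof (rule sum_mono)
      fix v
      have "(\<Sum>u\<in>nbrs G v. y u) * y v \<le> \<bar>\<Sum>u\<in>nbrs G v. y u\<bar> * \<bar>y v\<bar>" by (metis abs_ge_self abs_mult)
      also have "\<dots> \<le> (\<Sum>u\<in>nbrs G v. \<bar>y u\<bar>) * \<bar>y v\<bar>" by (intro mult_right_mono) auto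
      finally show "(\<Sum>u\<in>nbrs G v. y u) * y v \<le> (\<Sum>u\<in>nbrs G v. \<bar>y u\<bar>) * \<bar>y v\<bar>" .
    qed
    ultimately have "adj_form G y y \<le> \<mu> * s^2"
      using spos by (smt (verit) divide_le_eq zero_less_power)
    then show ?thesis by (simp add: s2)
  qed
  have eig: "(\<Sum>u\<in>nbrs G v. x u) = \<mu> * x v" if v: "v \<in> ?V" for v
  proof -
    define e where "e w = (if w = v then 1 else 0 :: real)" for w
    have ev: "(\<Sum>w\<in>?V. f w * e w) = f v" for f :: "'a \<Rightarrow> real"
    proof -
      have "(\<Sum>w\<in>?V. f w * e w) = (\<Sum>w\<in>?V. if v = w then f w else 0)"
        by (intro sum.cong) (auto simp: e_def)
      then show ?thesis using v fV by simp
    qed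
    define c where "c = \<mu> * x v - (\<Sum>u\<in>nbrs G v. x u)"
    define q where "q = \<mu> - adj_form G e e"
    \<comment> \<open>First-order optimality: a quadratic in \<open>t\<close> without constant term
      is nonnegative everywhere only if its linear coefficient vanishes.\<close>
    have *: "0 \<le> 2 * t * c + t^2 * q" for t
    proof -
      have "adj_form G x e = (\<Sum>u\<in>nbrs G v. x u)" unfolding adj_form_def ev ..
      then have "adj_form G (\<lambda>w. x w + t * e w) (\<lambda>w. x w + t * e w)
        = \<mu> + 2 * t * (\<Sum>u\<in>nbrs G v. x u) + t^2 * adj_form G e e"
        unfolding adj_form_add_scaled[OF G] \<mu>_def by simp
      moreover have "(\<Sum>w\<in>?V. (x w + t * e w)^2) = 1 + 2 * t * x v + t^2"
      proof -
        have "(\<Sum>w\<in>?V. (x w + t * e w)^2) = (\<Sum>w\<in>?V. (x w)^2) + 2 * t * (\<Sum>w\<in>?V. x w * e w) + t^2 * (\<Sum>w\<in>?V. e w * e w)"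
          by (simp add: power2_eq_square algebra_simps sum.distrib sum_distrib_left)
        then show ?thesis unfolding ev x1 by (simp add: e_def)
      qed
      ultimately show ?thesis using ray[of "\<lambda>w. x w + t * e w"]
        by (simp add: c_def q_def algebra_simps)
    qed
    have "c = 0"
    proof (rule ccontr)
      assume c: "c \<noteq> 0"
      define p where "p = \<bar>q\<bar> + 1"
      have p: "p > 0" "q < p" by (auto simp: p_def)
      have "2 * (- c / p) * c + (- c / p)^2 * q = (c^2 / p^2) * (q - 2 * p)"
        using p by (simp add: field_simps power2_eq_square)
      moreover have "(c^2 / p^2) * (q - 2 * p) < 0"
        using c p by (intro mult_pos_neg) auto
      ultimately show False using *[of "- c / p"] by linarith
    qed
    then show ?thesis by (simp add: c_def)
  qed
  have "\<exists>v\<in>?V. x v \<noteq> 0"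
  proof (rule ccontr)
    assume "\<not> ?thesis"
    then have "(\<Sum>v\<in>?V. (x v)^2) = 0" by simp
    then show False using x1 by simp
  qed
  then show ?thesis using x0 eig ray by (intro that[of x \<mu>])
qed

text \<open>The Rayleigh bound with \<open>\<mu>\<close>, tested on an eigenvector for any
  eigenvalue \<open>\<nu>\<close>, gives \<open>\<nu> \<le> \<mu>\<close>; so the maximum of the
  form is the largest eigenvalue.\<close>

lemma spec_rad_perron:
  fixes G :: "'a set set"
  assumes G: "simple_graph G" and ne: "G \<noteq> {}"
  obtains x where "\<And>v. v \<in> verts G \<Longrightarrow> 0 \<le> x v" "\<exists>v\<in>verts G. x v \<noteq> 0"
    "\<And>v. v \<in> verts G \<Longrightarrow> (\<Sum>u\<in>nbrs G v. x u) = spec_rad G * x v"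
    "\<And>y. adj_form G y y \<le> spec_rad G * (\<Sum>v\<in>verts G. (y v)^2)"
proof (rule perron_exists[OF G ne])
  fix \<mu> x assume x: "\<And>v. v \<in> verts G \<Longrightarrow> 0 \<le> x v" "\<exists>v\<in>verts G. x v \<noteq> 0"
    "\<And>v. v \<in> verts G \<Longrightarrow> (\<Sum>u\<in>nbrs G v. x u) = \<mu> * x v"
    "\<And>y. adj_form G y y \<le> \<mu> * (\<Sum>v\<in>verts G. (y v)^2)"
  have "spec_rad G = \<mu>"
    unfolding spec_rad_def
  proof (rule Max_eqI[OF finite_eigenvalues[OF G]])
    fix \<nu> assume "\<nu> \<in> {\<mu>. adj_eigenvalue G \<mu>}"
    then obtain y where y: "\<exists>v\<in>verts G. y v \<noteq> 0" "\<And>v. v \<in> verts G \<Longrightarrow> (\<Sum>u\<in>nbrs G v. y u) = \<nu> * y v"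
      using adj_eigenvalue_iff[OF G] by auto
    then obtain v where "v \<in> verts G" "y v \<noteq> 0" by blast
    then have pos: "(\<Sum>v\<in>verts G. (y v)^2) > 0"
      by (intro sum_pos2[OF finite_verts[OF G], of v]) auto
    have "\<nu> * (\<Sum>v\<in>verts G. (y v)^2) \<le> \<mu> * (\<Sum>v\<in>verts G. (y v)^2)"
      using adj_form_eigen[OF y(2), of y] x(4)[of y] by (simp add: power2_eq_square)
    then show "\<nu> \<le> \<mu>" using pos by simp
  next
    have "adj_eigenvalue G \<mu>" unfolding adj_eigenvalue_iff[OF G] using x(2,3) by (intro exI[of _ x] conjI ballI)
    then show "\<mu> \<in> {\<mu>. adj_eigenvalue G \<mu>}" by simp
  qed
  then have "\<mu> = spec_rad G" by (rule sym)
  then show ?thesis using that[of x] x by metis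
qed

lemma rayleigh_le_spec_rad:
  assumes "simple_graph G"
  shows "adj_form G y y \<le> spec_rad G * (\<Sum>v\<in>verts G. (y v)^2)"
proof (cases "G = {}")
  case True
  then show ?thesis by (simp add: adj_form_def verts_def)
next
  case False
  show ?thesis by (rule spec_rad_perron[OF assms False])
qed

text \<open>Supplies the easy direction of the equality cases: eigenvectors are carried along the
  vertex bijection and along its inverse.\<close>

lemma spec_rad_iso:
  assumes "graph_iso G H" "simple_graph G" "simple_graph H"
  shows "spec_rad G = spec_rad H"
proof -
  obtain f where f: "bij_betw f (verts G) (verts H)" "(\<lambda>e. f ` e) ` G = H"
    using assms(1) unfolding graph_iso_def by blast
  have inj: "inj_on f (verts G)" using f(1) bij_betw_def by blast
  have edge: "{f u, f v} \<in> H \<longleftrightarrow> {u,v} \<in> G" if "u \<in> verts G" "v \<in> verts G" for u v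
  proof
    assume "{f u, f v} \<in> H"
    then obtain e where e: "e \<in> G" "{f u, f v} = f ` e" using f(2) by auto
    then have "f ` {u,v} = f ` e" by simp
    moreover have "e \<subseteq> verts G" using e by (auto simp: verts_def)
    ultimately have "{u,v} = e" using inj that by (metis empty_subsetI inj_on_image_eq_iff insert_subset)
    then show "{u,v} \<in> G" using e by simp
  next
    assume "{u,v} \<in> G"
    then have "f ` {u,v} \<in> H" using f(2) by blast
    then show "{f u, f v} \<in> H" by simp
  qed
  have "adj_eigenvalue G \<mu> \<longleftrightarrow> adj_eigenvalue H \<mu>" for \<mu>
  proof
    assume "adj_eigenvalue H \<mu>"
    then obtain x where x: "\<exists>v\<in>verts H. x v \<noteq> 0"
      "\<forall>v\<in>verts H. (\<Sum>u\<in>verts H. (if {u,v} \<in> H then 1 else 0) * x u) = \<mu> * x v"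
      unfolding adj_eigenvalue_def by blast
    have "(\<Sum>u\<in>verts G. (if {u,v} \<in> G then 1 else 0) * x (f u)) = \<mu> * x (f v)" if "v \<in> verts G" for v
    proof -
      have "(\<Sum>u\<in>verts G. (if {u,v} \<in> G then 1 else 0) * x (f u))
        = (\<Sum>u\<in>verts G. (if {f u, f v} \<in> H then 1 else 0) * x (f u))"
        using edge that by (intro sum.cong) auto
      also have "\<dots> = (\<Sum>u\<in>verts H. (if {u, f v} \<in> H then 1 else 0) * x u)"
        by (rule sum.reindex_bij_betw[OF f(1)])
      finally have "(\<Sum>u\<in>verts G. (if {u,v} \<in> G then 1 else 0) * x (f u))
        = (\<Sum>u\<in>verts H. (if {u, f v} \<in> H then 1 else 0) * x u)" .
      moreover have "f v \<in> verts H" using bij_betwE[OF f(1)] that by blast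
      ultimately show ?thesis using x(2) by simp
    qed
    moreover have "\<exists>v\<in>verts G. x (f v) \<noteq> 0" using x(1) f(1) by (metis bij_betw_imp_surj_on imageE)
    ultimately show "adj_eigenvalue G \<mu>" unfolding adj_eigenvalue_def by (intro exI[of _ "\<lambda>v. x (f v)"]) blast
  next
    assume "adj_eigenvalue G \<mu>"
    then obtain x where x: "\<exists>v\<in>verts G. x v \<noteq> 0"
      "\<forall>v\<in>verts G. (\<Sum>u\<in>verts G. (if {u,v} \<in> G then 1 else 0) * x u) = \<mu> * x v"
      unfolding adj_eigenvalue_def by blast
    define g where "g = inv_into (verts G) f"
    have g: "bij_betw g (verts H) (verts G)" unfolding g_def by (rule bij_betw_inv_into[OF f(1)])
    have gf: "g (f v) = v" if "v \<in> verts G" for v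
      unfolding g_def using inj that by (rule inv_into_f_f)
    have "(\<Sum>u\<in>verts H. (if {u,v} \<in> H then 1 else 0) * x (g u)) = \<mu> * x (g v)" if vH: "v \<in> verts H" for v
    proof -
      obtain v' where v': "v' \<in> verts G" "v = f v'" using vH f(1) by (metis bij_betw_imp_surj_on imageE)
      have "(\<Sum>u\<in>verts H. (if {u,v} \<in> H then 1 else 0) * x (g u))
        = (\<Sum>u\<in>verts G. (if {f u, v} \<in> H then 1 else 0) * x (g (f u)))"
        by (rule sum.reindex_bij_betw[OF f(1), symmetric])
      also have "\<dots> = (\<Sum>u\<in>verts G. (if {u, v'} \<in> G then 1 else 0) * x u)"
        using edge v' gf by (intro sum.cong) auto
      finally show ?thesis using x(2) v' gf by simp
    qed
    moreover have "\<exists>v\<in>verts H. x (g v) \<noteq> 0" using x(1) g by (metis bij_betw_imp_surj_on imageE)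
    ultimately show "adj_eigenvalue H \<mu>" unfolding adj_eigenvalue_def by (intro exI[of _ "\<lambda>v. x (g v)"]) blast
  qed
  then show ?thesis by (simp add: spec_rad_def)
qed

section \<open>Lower bounds for the extremal graphs\<close>

lemma bij_betw_nbrs_edges:
  assumes "simple_graph G"
  shows "bij_betw (\<lambda>u. {u,v}) (nbrs G v) {e\<in>G. v \<in> e}"
  unfolding bij_betw_def
proof
  show "inj_on (\<lambda>u. {u,v}) (nbrs G v)"
    by (auto simp: inj_on_def doubleton_eq_iff)
  show "(\<lambda>u. {u,v}) ` nbrs G v = {e\<in>G. v \<in> e}"
  proof (intro subset_antisym subsetI)
    fix e assume e: "e \<in> {e\<in>G. v \<in> e}"
    then have "card e = 2" using assms unfolding simple_graph_def by blast
    then obtain a b where "e = {a,b}" unfolding card_2_iff by blast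
    with e show "e \<in> (\<lambda>u. {u,v}) ` nbrs G v" by (auto simp: nbrs_def insert_commute)
  qed (auto simp: nbrs_def)
qed

text \<open>Each edge is seen from both of its ends, hence the factor 2. As a sum over edges, the
  form of an explicit graph can be read off its edge list.\<close>

lemma adj_form_edges:
  assumes G: "simple_graph G"
  shows "adj_form G x x = 2 * (\<Sum>e\<in>G. \<Prod>v\<in>e. x v)"
proof -
  have fV: "finite (verts G)" and fG: "finite G"
    using G finite_verts by (auto simp: simple_graph_def)
  have *: "(\<Sum>u\<in>nbrs G v. x u) * x v = (\<Sum>e\<in>G. if v \<in> e then \<Prod>w\<in>e. x w else 0)" for v
  proof -
    have "(\<Sum>u\<in>nbrs G v. x u) * x v = (\<Sum>u\<in>nbrs G v. \<Prod>w\<in>{u,v}. x w)"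
      unfolding sum_distrib_right using not_nbrs_self[OF G, of v]
      by (intro sum.cong refl, subst prod.insert) auto
    also have "\<dots> = (\<Sum>e\<in>{e\<in>G. v \<in> e}. \<Prod>w\<in>e. x w)"
      by (rule sum.reindex_bij_betw[OF bij_betw_nbrs_edges[OF G]])
    also have "\<dots> = (\<Sum>e\<in>G. if v \<in> e then \<Prod>w\<in>e. x w else 0)"
      using fG by (rule sum.inter_filter)
    finally show ?thesis .
  qed
  have "adj_form G x x = (\<Sum>e\<in>G. \<Sum>v\<in>verts G. if v \<in> e then \<Prod>w\<in>e. x w else 0)"
    unfolding adj_form_def * by (rule sum.swap)
  also have "\<dots> = (\<Sum>e\<in>G. 2 * (\<Prod>w\<in>e. x w))"
  proof (rule sum.cong[OF refl])
    fix e assume e: "e \<in> G"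
    then have "verts G \<inter> e = e" by (auto simp: verts_def)
    moreover have "card e = 2" using G e by (simp add: simple_graph_def)
    moreover have "(\<Sum>v\<in>verts G. if v \<in> e then \<Prod>w\<in>e. x w else 0) = (\<Sum>v\<in>verts G \<inter> e. \<Prod>w\<in>e. x w)"
      using fV by (rule sum.inter_restrict[symmetric])
    ultimately show "(\<Sum>v\<in>verts G. if v \<in> e then \<Prod>w\<in>e. x w else 0) = 2 * (\<Prod>w\<in>e. x w)"
      by simp
  qed
  finally show ?thesis by (simp add: sum_distrib_left)
qed

lemma rayleigh_edges:
  assumes "simple_graph G"
  shows "2 * (\<Sum>e\<in>G. \<Prod>v\<in>e. y v) \<le> spec_rad G * (\<Sum>v\<in>verts G. (y v)^2)"
  using rayleigh_le_spec_rad[OF assms, of y] adj_form_edges[OF assms, of y] by simp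

section \<open>Edges and vertices of the three extremal families\<close>

lemma Y_graph_eq:
  assumes "m = 3 * k + 3"
  shows "Y_graph m = {{0,1},{1,2},{2,3}} \<union> (\<Union>i\<in>{5..<5+k}. {{i,0},{i,3},{i,4}})"
  using assms by (simp add: Y_graph_def)

lemma T_graph_eq:
  assumes "m = 3 * k + 4"
  shows "T_graph m = {{3,0},{4,0},{0,1},{1,2}} \<union> (\<Union>i\<in>{5..<5+k}. {{i,2},{i,3},{i,4}})"
  using assms by (simp add: T_graph_def)

lemma L_graph_eq:
  assumes "m = 2 * k + 6"
  shows "L_graph m = {{0,1},{1,2},{2,3},{3,4},{4,0},{0,5}} \<union> (\<Union>i\<in>{6..<6+k}. {{i,0},{i,2}})"
  using assms by (simp add: L_graph_def)

lemma simple_Y_graph: "m = 3 * k + 3 \<Longrightarrow> simple_graph (Y_graph m)"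
  unfolding Y_graph_eq simple_graph_def by auto

lemma simple_T_graph: "m = 3 * k + 4 \<Longrightarrow> simple_graph (T_graph m)"
  unfolding T_graph_eq simple_graph_def by auto

lemma simple_L_graph: "m = 2 * k + 6 \<Longrightarrow> simple_graph (L_graph m)"
  unfolding L_graph_eq simple_graph_def by auto

text \<open>Vertex 4 lies only on edges to \<open>{5..<5+k}\<close>, so \<open>k \<ge> 1\<close>
  keeps it from being isolated.\<close>

lemma verts_Y_graph: 
  assumes "m = 3 * k + 3" "k \<ge> 1"
  shows "verts (Y_graph m) = {0,1,2,3,4} \<union> {5..<5+k}"
proof -
  have "\<exists>i\<ge>5. i < 5 + k" using assms(2) by (intro exI[of _ 5]) simp
  then show ?thesis unfolding Y_graph_eq[OF assms(1)] verts_def by auto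
qed

lemma verts_T_graph: "m = 3 * k + 4 \<Longrightarrow> verts (T_graph m) = {0,1,2,3,4} \<union> {5..<5+k}"
  unfolding T_graph_eq verts_def by auto

lemma verts_L_graph: "m = 2 * k + 6 \<Longrightarrow> verts (L_graph m) = {0,1,2,3,4,5} \<union> {6..<6+k}"
  unfolding L_graph_eq verts_def by auto

lemma sum_edges_Y_graph:
  fixes f :: "nat set \<Rightarrow> real"
  assumes "m = 3 * k + 3"
  shows "(\<Sum>e\<in>Y_graph m. f e) = f {0,1} + f {1,2} + f {2,3} + (\<Sum>i\<in>{5..<5+k}. f {i,0} + f {i,3} + f {i,4})"
proof -
  have "(\<Sum>e\<in>Y_graph m. f e) = sum f {{0,1},{1,2},{2,3}} + sum f (\<Union>i\<in>{5..<5+k}. {{i,0},{i,3},{i,4}})"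
    unfolding Y_graph_eq[OF assms]
    by (rule sum.union_disjoint) (auto simp: doubleton_eq_iff)
  also have "sum f (\<Union>i\<in>{5..<5+k}. {{i,0},{i,3},{i,4}}) = (\<Sum>i\<in>{5..<5+k}. sum f {{i,0},{i,3},{i,4}})"
    by (rule sum.UNION_disjoint) (auto simp: doubleton_eq_iff)
  also have "\<dots> = (\<Sum>i\<in>{5..<5+k}. f {i,0} + f {i,3} + f {i,4})"
    by (intro sum.cong refl) (simp add: doubleton_eq_iff)
  finally show ?thesis by (simp add: doubleton_eq_iff)
qed

lemma sum_edges_T_graph:
  fixes f :: "nat set \<Rightarrow> real"
  assumes "m = 3 * k + 4"
  shows "(\<Sum>e\<in>T_graph m. f e) = f {3,0} + f {4,0} + f {0,1} + f {1,2} + (\<Sum>i\<in>{5..<5+k}. f {i,2} + f {i,3} + f {i,4})"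
proof -
  have "(\<Sum>e\<in>T_graph m. f e) = sum f {{3,0},{4,0},{0,1},{1,2}} + sum f (\<Union>i\<in>{5..<5+k}. {{i,2},{i,3},{i,4}})"
    unfolding T_graph_eq[OF assms]
    by (rule sum.union_disjoint) (auto simp: doubleton_eq_iff)
  also have "sum f (\<Union>i\<in>{5..<5+k}. {{i,2},{i,3},{i,4}}) = (\<Sum>i\<in>{5..<5+k}. sum f {{i,2},{i,3},{i,4}})"
    by (rule sum.UNION_disjoint) (auto simp: doubleton_eq_iff)
  also have "\<dots> = (\<Sum>i\<in>{5..<5+k}. f {i,2} + f {i,3} + f {i,4})"
    by (intro sum.cong refl) (simp add: doubleton_eq_iff)
  finally show ?thesis by (simp add: doubleton_eq_iff)
qed

lemma sum_edges_L_graph: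
  fixes f :: "nat set \<Rightarrow> real"
  assumes "m = 2 * k + 6"
  shows "(\<Sum>e\<in>L_graph m. f e) = f {0,1} + f {1,2} + f {2,3} + f {3,4} + f {4,0} + f {0,5}
    + (\<Sum>i\<in>{6..<6+k}. f {i,0} + f {i,2})"
proof -
  have "(\<Sum>e\<in>L_graph m. f e) = sum f {{0,1},{1,2},{2,3},{3,4},{4,0},{0,5}} + sum f (\<Union>i\<in>{6..<6+k}. {{i,0},{i,2}})"
    unfolding L_graph_eq[OF assms]
    by (rule sum.union_disjoint) (auto simp: doubleton_eq_iff)
  also have "sum f (\<Union>i\<in>{6..<6+k}. {{i,0},{i,2}}) = (\<Sum>i\<in>{6..<6+k}. sum f {{i,0},{i,2}})"
    by (rule sum.UNION_disjoint) (auto simp: doubleton_eq_iff)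
  also have "\<dots> = (\<Sum>i\<in>{6..<6+k}. f {i,0} + f {i,2})"
    by (intro sum.cong refl) (simp add: doubleton_eq_iff)
  finally show ?thesis by (simp add: doubleton_eq_iff)
qed

text \<open>In the test vector the vertices 0, 3, 4 get weight 1, and every other vertex gets its
  number of neighbours among them divided by \<open>\<mu>\<close>. With
  \<open>\<mu>^2 = m - 7/3\<close> the form exceeds \<open>\<mu>\<close> times the squared norm
  exactly by the contribution of the edge \<open>{1,2}\<close>.\<close>

lemma spec_rad_Y_graph_ge:
  assumes m: "m = 3 * k + 3" and k: "k \<ge> 1"
  shows "sqrt (real m - 7/3) \<le> spec_rad (Y_graph m)"
proof -
  define \<mu> where "\<mu> = sqrt (real m - 7/3)"
  have \<mu>: "\<mu> > 0" "\<mu>^2 = 3 * real k + 2/3" using m k by (auto simp: \<mu>_def)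
  define y :: "nat \<Rightarrow> real" where "y i = (if i \<ge> 5 then 3/\<mu> else if i = 1 \<or> i = 2 then 1/\<mu> else 1)" for i
  let ?S = "\<Sum>v\<in>verts (Y_graph m). (y v)^2"
  have S: "?S = 3 + 2/\<mu>^2 + 9 * k/\<mu>^2"
    unfolding verts_Y_graph[OF m k] by (subst sum.union_disjoint) (auto simp: y_def power_divide)
  have E: "(\<Sum>e\<in>Y_graph m. \<Prod>v\<in>e. y v) = 2/\<mu> + 1/\<mu>^2 + 9 * k/\<mu>"
    unfolding sum_edges_Y_graph[OF m] by (simp add: y_def power2_eq_square)
  have Spos: "?S > 0" unfolding S using \<mu> by (simp add: add_pos_nonneg)
  have "\<mu> * ?S = 3 * \<mu> + 2/\<mu> + 9 * k/\<mu>" unfolding S using \<mu>(1) by (simp add: field_simps power2_eq_square)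
  also have "3 * \<mu> = (9 * real k + 2)/\<mu>" using \<mu> by (simp add: field_simps power2_eq_square)
  also have "(9 * real k + 2)/\<mu> + 2/\<mu> + 9 * k/\<mu> = 2 * (2/\<mu> + 9 * k/\<mu>)" by (simp add: add_divide_distrib)
  also have "\<dots> \<le> 2 * (\<Sum>e\<in>Y_graph m. \<Prod>v\<in>e. y v)" unfolding E by simp
  also have "\<dots> \<le> spec_rad (Y_graph m) * ?S" by (rule rayleigh_edges[OF simple_Y_graph[OF m]])
  finally show ?thesis using Spos unfolding \<mu>_def[symmetric] by simp
qed

text \<open>The same choice of weights, with \<open>{2,3,4}\<close> as the class of weight 1; the
  surplus now comes from the edge \<open>{0,1}\<close>.\<close>

lemma spec_rad_T_graph_ge:
  assumes m: "m = 3 * k + 4"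
  shows "sqrt (real m - 7/3) \<le> spec_rad (T_graph m)"
proof -
  define \<mu> where "\<mu> = sqrt (real m - 7/3)"
  have \<mu>: "\<mu> > 0" "\<mu>^2 = 3 * real k + 5/3" using m by (auto simp: \<mu>_def)
  define y :: "nat \<Rightarrow> real" where "y i = (if i \<ge> 5 then 3/\<mu> else if i = 0 then 2/\<mu> else if i = 1 then 1/\<mu> else 1)" for i
  let ?S = "\<Sum>v\<in>verts (T_graph m). (y v)^2"
  have S: "?S = 3 + 5/\<mu>^2 + 9 * k/\<mu>^2"
    unfolding verts_T_graph[OF m] by (subst sum.union_disjoint) (auto simp: y_def power_divide)
  have E: "(\<Sum>e\<in>T_graph m. \<Prod>v\<in>e. y v) = 5/\<mu> + 2/\<mu>^2 + 9 * k/\<mu>"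
    unfolding sum_edges_T_graph[OF m] by (simp add: y_def power2_eq_square)
  have Spos: "?S > 0" unfolding S using \<mu> by (simp add: add_pos_nonneg)
  have "\<mu> * ?S = 3 * \<mu> + 5/\<mu> + 9 * k/\<mu>" unfolding S using \<mu>(1) by (simp add: field_simps power2_eq_square)
  also have "3 * \<mu> = (9 * real k + 5)/\<mu>" using \<mu> by (simp add: field_simps power2_eq_square)
  also have "(9 * real k + 5)/\<mu> + 5/\<mu> + 9 * k/\<mu> = 2 * (5/\<mu> + 9 * k/\<mu>)" by (simp add: add_divide_distrib)
  also have "\<dots> \<le> 2 * (\<Sum>e\<in>T_graph m. \<Prod>v\<in>e. y v)" unfolding E by simp
  also have "\<dots> \<le> spec_rad (T_graph m) * ?S" by (rule rayleigh_edges[OF simple_T_graph[OF m]])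
  finally show ?thesis using Spos unfolding \<mu>_def[symmetric] by simp
qed

text \<open>Testing with 2/\<open>\<mu>\<close> on common neighbours and \<open>c\<close> on the two remaining cycle vertices; the
  optimal \<open>c = 1/(\<mu> - 1)\<close> depends on the unknown \<open>\<mu>\<close>, so a cruder \<open>c\<close> first gives \<open>\<mu> > 1\<close>.\<close>

lemma rayleigh_L_graph:
  fixes m k :: nat
  assumes m: "m = 2 * k + 6" and \<mu>: "\<mu> > 0"
  shows "2 * (4 * (k + 1)/\<mu> + 1/\<mu> + 2 * c + c^2)
    \<le> spec_rad (L_graph m) * (2 + 4 * (k + 1)/\<mu>^2 + 1/\<mu>^2 + 2 * c^2)"
proof -
  define y :: "nat \<Rightarrow> real" where
    "y i = (if i \<ge> 6 \<or> i = 1 then 2/\<mu> else if i = 5 then 1/\<mu> else if i = 3 \<or> i = 4 then c else 1)" for i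
  have "(\<Sum>v\<in>verts (L_graph m). (y v)^2) = 2 + 4 * (k + 1)/\<mu>^2 + 1/\<mu>^2 + 2 * c^2"
    unfolding verts_L_graph[OF m]
    by (subst sum.union_disjoint) (auto simp: y_def power_divide algebra_simps add_divide_distrib)
  moreover have "(\<Sum>e\<in>L_graph m. \<Prod>v\<in>e. y v) = 4 * (k + 1)/\<mu> + 1/\<mu> + 2 * c + c^2"
    unfolding sum_edges_L_graph[OF m] using \<mu> by (simp add: y_def power2_eq_square field_simps)
  ultimately show ?thesis using rayleigh_edges[OF simple_L_graph[OF m], of y] by simp
qed

text \<open>The value \<open>c = 1 / (\<nu> - 1)\<close> used for the second bound solves
  \<open>\<nu> * c = 1 + c\<close>, the eigenvalue equation at the adjacent vertices 3 and 4. The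
  extra term that it yields enters the exclusion of large \<open>s\<close> in
  \<open>no_large_side\<close>.\<close>

lemma spec_rad_L_graph_ge:
  fixes m k :: nat
  assumes m: "m = 2 * k + 6"
  shows "sqrt (real m - 5/2) \<le> spec_rad (L_graph m)"
    and "real m - 5/2 + 1 / (spec_rad (L_graph m) - 1) \<le> (spec_rad (L_graph m))^2"
proof -
  define \<mu> where "\<mu> = sqrt (real m - 5/2)"
  have \<mu>: "\<mu> > 1" "\<mu>^2 = 2 * real k + 7/2" using m by (auto simp: \<mu>_def)
  let ?S = "2 + 4 * (k + 1)/\<mu>^2 + 1/\<mu>^2 + 2 * (1/\<mu>)^2"
  have "\<mu> * ?S = 2 * \<mu> + (4 * k + 7)/\<mu>" using \<mu>(1) by (simp add: field_simps power2_eq_square)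
  also have "2 * \<mu> = (4 * real k + 7)/\<mu>" using \<mu> by (simp add: field_simps power2_eq_square)
  also have "(4 * real k + 7)/\<mu> + (4 * k + 7)/\<mu> \<le> 2 * (4 * (k + 1)/\<mu> + 1/\<mu> + 2 * (1/\<mu>) + (1/\<mu>)^2)"
    using \<mu>(1) by (simp add: field_simps power2_eq_square)
  also have "\<dots> \<le> spec_rad (L_graph m) * ?S" using \<mu>(1) by (intro rayleigh_L_graph[OF m]) simp
  finally have "\<mu> * ?S \<le> spec_rad (L_graph m) * ?S" .
  moreover have "?S > 0" by (simp add: add_pos_nonneg)
  ultimately show *: "sqrt (real m - 5/2) \<le> spec_rad (L_graph m)"
    unfolding \<mu>_def[symmetric] by (simp only: mult_le_cancel_right_pos)
  define \<nu> where "\<nu> = spec_rad (L_graph m)"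
  have \<nu>: "\<nu> > 1" using * \<mu>(1) unfolding \<mu>_def \<nu>_def by linarith
  define c where "c = 1 / (\<nu> - 1)"
  have c: "c * (\<nu> - 1) = 1" using \<nu> by (simp add: c_def)
  define q where "q = (4 * (k + 1) + 1)/\<nu>"
  have q: "4 * (k + 1)/\<nu> + 1/\<nu> = q" by (simp add: q_def add_divide_distrib)
  have "2 * (q + 2 * c + c^2) \<le> \<nu> * (2 + 4 * (k + 1)/\<nu>^2 + 1/\<nu>^2 + 2 * c^2)"
    using rayleigh_L_graph[OF m, of \<nu> c] \<nu> unfolding \<nu>_def[symmetric] q[symmetric] by simp
  also have "\<dots> = 2 * \<nu> + q + 2 * \<nu> * c^2"
    using \<nu> by (simp add: q_def field_simps power2_eq_square)
  finally have "q + 4 * c \<le> 2 * \<nu> + 2 * (c * (\<nu> - 1)) * c"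
    by (simp add: algebra_simps power2_eq_square)
  then have "(4 * (k + 1) + 1)/\<nu> \<le> 2 * \<nu> - 2 * c" unfolding c q_def by simp
  then have "4 * (k + 1) + 1 \<le> (2 * \<nu> - 2 * c) * \<nu>" using \<nu> by (simp add: pos_divide_le_eq)
  also have "\<dots> = 2 * \<nu>^2 - 2 * (c * (\<nu> - 1)) - 2 * c" by (simp add: algebra_simps power2_eq_square)
  finally have "4 * (k + 1) + 1 \<le> 2 * \<nu>^2 - 2 - 2 * c" unfolding c by simp
  then show "real m - 5/2 + 1 / (spec_rad (L_graph m) - 1) \<le> (spec_rad (L_graph m))^2"
    unfolding \<nu>_def[symmetric] c_def[symmetric] using m by simp
qed

section \<open>Deficiency at a maximal vertex of the Perron vector\<close>

locale perron_vertex =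
  fixes G :: "'a set set" and x :: "'a \<Rightarrow> real" and \<rho> :: real and u :: 'a
  assumes simple: "simple_graph G" and tri_free: "triangle_free G"
    and x_nonneg: "\<And>v. v \<in> verts G \<Longrightarrow> 0 \<le> x v"
    and x_le_1: "\<And>v. v \<in> verts G \<Longrightarrow> x v \<le> 1"
    and u_verts: "u \<in> verts G" and x_u: "x u = 1"
    and eigen: "\<And>v. v \<in> verts G \<Longrightarrow> (\<Sum>w\<in>nbrs G v. x w) = \<rho> * x v"
begin

definition A where "A = nbrs G u"
definition B where "B = verts G - insert u A"
definition d where "d w = card (nbrs G w \<inter> A)"
definition EB where "EB = {e \<in> G. e \<subseteq> B}"

section \<open>Edge count and walks of length two from \<open>u\<close>\<close>

lemma finite_G: "finite G" and card_edge: "e \<in> G \<Longrightarrow> card e = 2"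
  using simple by (auto simp: simple_graph_def)

lemma finite_A: "finite A" and finite_B: "finite B" and finite_EB: "finite EB"
  and A_subset: "A \<subseteq> verts G" and B_subset: "B \<subseteq> verts G"
  using finite_nbrs[OF simple] finite_verts[OF simple] finite_G nbrs_subset_verts[of G u]
  by (auto simp: A_def B_def EB_def)

lemma u_notin_A: "u \<notin> A" and u_notin_B: "u \<notin> B" and A_Int_B: "A \<inter> B = {}"
  using not_nbrs_self[OF simple] by (auto simp: A_def B_def)

lemma verts_eq: "verts G = insert u (A \<union> B)"
  using A_subset u_verts by (auto simp: B_def)

lemma no_triangle: "q \<in> nbrs G p \<Longrightarrow> r \<in> nbrs G p \<Longrightarrow> r \<notin> nbrs G q"
  using tri_free unfolding triangle_free_def nbrs_def by (auto simp: insert_commute)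

lemma nbrs_of_A: "v \<in> A \<Longrightarrow> nbrs G v = insert u (nbrs G v \<inter> B)"
  using no_triangle[of v u] nbrs_subset_verts[of G v] nbrs_commute[of v G u]
  unfolding verts_eq A_def[symmetric] by auto

lemma nbrs_of_B: "w \<in> B \<Longrightarrow> nbrs G w = (nbrs G w \<inter> A) \<union> (nbrs G w \<inter> B)"
  using nbrs_subset_verts[of G w] nbrs_commute[of w G u] A_Int_B
  unfolding verts_eq A_def[symmetric] by (auto simp: B_def)

lemma edge_verts: "{p,q} \<in> G \<Longrightarrow> p \<in> verts G \<and> q \<in> verts G \<and> p \<noteq> q"
  using card_edge[of "{p,q}"] by (auto simp: verts_def)

lemma edge_obtain:
  assumes "e \<in> G"
  obtains p q where "e = {p,q}" "p \<noteq> q"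
  using card_edge[OF assms] unfolding card_2_iff by blast

text \<open>\<open>A\<close> is independent, so an edge contains \<open>u\<close>, lies inside
  \<open>B\<close>, or joins \<open>A\<close> to \<open>B\<close>; \<open>M\<close> is the last
  class.\<close>

lemma card_edges: "card G = card A + (\<Sum>w\<in>B. d w) + card EB"
proof -
  define M where "M = {e\<in>G. u \<notin> e \<and> \<not> e \<subseteq> B}"
  have G: "G = {e\<in>G. u \<in> e} \<union> M \<union> EB"
    using u_notin_B by (auto simp: M_def EB_def)
  have "card G = card ({e\<in>G. u \<in> e} \<union> M \<union> EB)" using G by simp
  also have "\<dots> = card {e\<in>G. u \<in> e} + card M + card EB"
    using finite_G finite_EB u_notin_B
    by (subst card_Un_disjoint, auto simp: M_def EB_def)+
  also have "card {e\<in>G. u \<in> e} = card A"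
    unfolding A_def by (rule bij_betw_same_card[OF bij_betw_nbrs_edges[OF simple], symmetric])
  also have "card M = card (SIGMA w:B. nbrs G w \<inter> A)"
  proof (rule bij_betw_same_card[symmetric])
    show "bij_betw (\<lambda>(w,v). {v,w}) (SIGMA w:B. nbrs G w \<inter> A) M"
      unfolding bij_betw_def
    proof
      show "inj_on (\<lambda>(w,v). {v,w}) (SIGMA w:B. nbrs G w \<inter> A)"
        using A_Int_B by (auto simp: inj_on_def doubleton_eq_iff)
      show "(\<lambda>(w,v). {v,w}) ` (SIGMA w:B. nbrs G w \<inter> A) = M"
      proof (intro subset_antisym subsetI)
        fix e assume "e \<in> (\<lambda>(w,v). {v,w}) ` (SIGMA w:B. nbrs G w \<inter> A)"
        then obtain w v where "e = {v,w}" "w \<in> B" "v \<in> nbrs G w" "v \<in> A" by auto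
        then show "e \<in> M" using u_notin_A u_notin_B A_Int_B unfolding M_def nbrs_def by auto
      next
        fix e assume e: "e \<in> M"
        then obtain p q where pq: "e = {p,q}" "p \<noteq> q" using edge_obtain unfolding M_def by blast
        have pq': "{p,q} \<in> G" "u \<noteq> p" "u \<noteq> q" "p \<notin> B \<or> q \<notin> B" using e pq unfolding M_def by auto
        then have v: "p \<in> A \<union> B" "q \<in> A \<union> B" using edge_verts[OF pq'(1)] verts_eq by auto
        have adj: "p \<in> nbrs G q" "q \<in> nbrs G p" using pq'(1) by (auto simp: nbrs_def insert_commute)
        have "\<not> (p \<in> A \<and> q \<in> A)" using no_triangle[of p u q] adj unfolding A_def by blast
        then consider "p \<in> A" "q \<in> B" | "p \<in> B" "q \<in> A" using v pq'(4) by blast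
        then show "e \<in> (\<lambda>(w,v). {v,w}) ` (SIGMA w:B. nbrs G w \<inter> A)"
        proof cases
          case 1
          then show ?thesis using adj pq by (intro image_eqI[of _ _ "(q,p)"]) auto
        next
          case 2
          then show ?thesis using adj pq by (intro image_eqI[of _ _ "(p,q)"]) auto
        qed
      qed
    qed
  qed
  also have "\<dots> = (\<Sum>w\<in>B. d w)"
    unfolding d_def using finite_A finite_B by (simp add: card_SigmaI)
  finally show ?thesis .
qed

lemma sum_A: "(\<Sum>v\<in>A. x v) = \<rho>"
  using eigen[OF u_verts] by (simp add: A_def x_u)

text \<open>The eigenvalue equation at \<open>u\<close> and then at its neighbours counts weighted
  walks of length two: each vertex of \<open>A\<close> returns to \<open>u\<close> once, and
  \<open>w\<close> in \<open>B\<close> is reached through its \<open>d w\<close> neighbours in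
  \<open>A\<close>.\<close>

lemma rho_square: "\<rho>^2 = card A + (\<Sum>w\<in>B. d w * x w)"
proof -
  have "\<rho>^2 = (\<Sum>v\<in>A. \<rho> * x v)" using sum_A by (simp add: sum_distrib_left[symmetric] power2_eq_square)
  also have "\<dots> = (\<Sum>v\<in>A. 1 + (\<Sum>w\<in>B. if v \<in> nbrs G w then x w else 0))"
  proof (rule sum.cong[OF refl])
    fix v assume v: "v \<in> A"
    have "\<rho> * x v = (\<Sum>w\<in>nbrs G v. x w)" using eigen v A_subset by auto
    also have "\<dots> = x u + (\<Sum>w\<in>nbrs G v \<inter> B. x w)"
      using u_notin_B finite_B by (subst nbrs_of_A[OF v]) simp
    also have "nbrs G v \<inter> B = {w\<in>B. v \<in> nbrs G w}" using nbrs_commute[of _ G v] by blast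
    also have "(\<Sum>w\<in>{w\<in>B. v \<in> nbrs G w}. x w) = (\<Sum>w\<in>B. if v \<in> nbrs G w then x w else 0)"
      using finite_B by (rule sum.inter_filter)
    finally show "\<rho> * x v = 1 + (\<Sum>w\<in>B. if v \<in> nbrs G w then x w else 0)" by (simp add: x_u)
  qed
  also have "\<dots> = card A + (\<Sum>v\<in>A. \<Sum>w\<in>B. if v \<in> nbrs G w then x w else 0)"
    by (simp add: sum.distrib)
  also have "(\<Sum>v\<in>A. \<Sum>w\<in>B. if v \<in> nbrs G w then x w else 0) = (\<Sum>w\<in>B. \<Sum>v\<in>A. if v \<in> nbrs G w then x w else 0)"
    by (rule sum.swap)
  also have "\<dots> = (\<Sum>w\<in>B. d w * x w)"
  proof (rule sum.cong[OF refl])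
    fix w
    have "(\<Sum>v\<in>A. if v \<in> nbrs G w then x w else 0) = (\<Sum>v\<in>A \<inter> nbrs G w. x w)"
      using finite_A by (rule sum.inter_restrict[symmetric])
    then show "(\<Sum>v\<in>A. if v \<in> nbrs G w then x w else 0) = d w * x w"
      by (simp add: d_def Int_commute)
  qed
  finally show ?thesis .
qed

text \<open>Every term on the right is nonnegative, so a large \<open>\<rho>\<close> leaves few
  edges inside \<open>B\<close> and forces vertices of \<open>B\<close> with many neighbours in
  \<open>A\<close> to have weight near 1.\<close>

lemma deficiency: "card G - \<rho>^2 = card EB + (\<Sum>w\<in>B. d w * (1 - x w))"
  unfolding rho_square card_edges by (simp add: algebra_simps sum_subtractf)

text \<open>Colour \<open>A \<union> S\<close> against all other vertices: no edge stays inside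
  \<open>A \<union> S\<close>, and an edge avoiding it would be an edge of \<open>EB\<close> that
  \<open>S\<close> does not meet.\<close>

lemma bipartite_if_cover:
  assumes "S \<subseteq> B" and "\<And>w. w \<in> S \<Longrightarrow> nbrs G w \<inter> A = {}"
    and "\<And>v w. v \<in> S \<Longrightarrow> w \<in> S \<Longrightarrow> {v,w} \<notin> G" and "\<And>e. e \<in> EB \<Longrightarrow> e \<inter> S \<noteq> {}"
  shows "bipartite G"
  unfolding bipartite_def
proof (intro exI[of _ "\<lambda>v. v \<in> A \<union> S"] allI impI)
  fix p q assume pq: "{p,q} \<in> G"
  have adj: "p \<in> nbrs G q" "q \<in> nbrs G p" using pq by (auto simp: nbrs_def insert_commute)
  show "(p \<in> A \<union> S) \<noteq> (q \<in> A \<union> S)"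
  proof
    assume same: "(p \<in> A \<union> S) = (q \<in> A \<union> S)"
    have "\<not> (p \<in> A \<and> q \<in> A)" using no_triangle[of p u q] adj unfolding A_def by blast
    with same assms(2,3) pq adj have "p \<notin> A \<union> S" "q \<notin> A \<union> S" by blast+
    then have "p \<in> B" "q \<in> B" using edge_verts[OF pq] adj verts_eq unfolding A_def by auto
    then have "{p,q} \<in> EB" using pq by (simp add: EB_def)
    then show False using assms(4) \<open>p \<notin> A \<union> S\<close> \<open>q \<notin> A \<union> S\<close> by blast
  qed
qed

text \<open>Without triangles the two ends have disjoint neighbourhoods in \<open>A\<close>, of
  total weight at most \<open>\<rho>\<close>. Neighbours inside \<open>B\<close> count at most 1
  each, and only \<open>{a,b}\<close> itself is counted from both ends.\<close>

lemma edge_in_B_sum: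
  assumes "{a,b} \<in> EB"
  shows "\<rho> * (x a + x b) \<le> \<rho> + card EB + 1"
proof -
  have ab: "{a,b} \<in> G" "a \<in> B" "b \<in> B" using assms by (auto simp: EB_def)
  have split: "\<rho> * x w \<le> (\<Sum>v\<in>nbrs G w \<inter> A. x v) + card {e\<in>EB. w \<in> e}" if w: "w \<in> B" for w
  proof -
    have "\<rho> * x w = (\<Sum>v\<in>(nbrs G w \<inter> A) \<union> (nbrs G w \<inter> B). x v)"
      using eigen w B_subset nbrs_of_B[OF w] by auto
    also have "\<dots> = (\<Sum>v\<in>nbrs G w \<inter> A. x v) + (\<Sum>v\<in>nbrs G w \<inter> B. x v)"
      using finite_A finite_B A_Int_B by (intro sum.union_disjoint) auto
    finally have "\<rho> * x w = (\<Sum>v\<in>nbrs G w \<inter> A. x v) + (\<Sum>v\<in>nbrs G w \<inter> B. x v)" .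
    moreover have "(\<Sum>v\<in>nbrs G w \<inter> B. x v) \<le> (\<Sum>v\<in>nbrs G w \<inter> B. 1)"
      using x_le_1 B_subset by (intro sum_mono) auto
    moreover have "card (nbrs G w \<inter> B) \<le> card {e\<in>EB. w \<in> e}"
    proof (rule card_inj_on_le)
      show "inj_on (\<lambda>v. {v,w}) (nbrs G w \<inter> B)" by (auto simp: inj_on_def doubleton_eq_iff)
    qed (use w finite_G in \<open>auto simp: nbrs_def EB_def\<close>)
    ultimately show ?thesis by simp
  qed
  have "nbrs G a \<inter> nbrs G b = {}"
    using no_triangle[of b a] ab nbrs_commute[of _ G b] by (auto simp: nbrs_def insert_commute)
  then have "(\<Sum>v\<in>nbrs G a \<inter> A. x v) + (\<Sum>v\<in>nbrs G b \<inter> A. x v) = (\<Sum>v\<in>(nbrs G a \<inter> A) \<union> (nbrs G b \<inter> A). x v)"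
    using finite_A by (intro sum.union_disjoint[symmetric]) auto
  also have "\<dots> \<le> (\<Sum>v\<in>A. x v)"
    using x_nonneg A_subset finite_A by (intro sum_mono2) auto
  finally have 1: "(\<Sum>v\<in>nbrs G a \<inter> A. x v) + (\<Sum>v\<in>nbrs G b \<inter> A. x v) \<le> \<rho>" unfolding sum_A .
  have card_sum: "card {e\<in>EB. a \<in> e} + card {e\<in>EB. b \<in> e}
    = card ({e\<in>EB. a \<in> e} \<union> {e\<in>EB. b \<in> e}) + card ({e\<in>EB. a \<in> e} \<inter> {e\<in>EB. b \<in> e})"
    using finite_EB by (intro card_Un_Int) auto
  have card_un: "card ({e\<in>EB. a \<in> e} \<union> {e\<in>EB. b \<in> e}) \<le> card EB"
    using finite_EB by (intro card_mono) auto
  have "{e\<in>EB. a \<in> e} \<inter> {e\<in>EB. b \<in> e} \<subseteq> {{a,b}}"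
  proof
    fix e assume e: "e \<in> {e\<in>EB. a \<in> e} \<inter> {e\<in>EB. b \<in> e}"
    then have "card e = 2" using card_edge by (auto simp: EB_def)
    moreover have "{a,b} \<subseteq> e" "card {a,b} = 2" using e card_edge[OF ab(1)] by auto
    moreover have "finite e" using \<open>card e = 2\<close> by (intro card_ge_0_finite) simp
    ultimately show "e \<in> {{a,b}}" using card_subset_eq[of e "{a,b}"] by simp
  qed
  then have "card ({e\<in>EB. a \<in> e} \<inter> {e\<in>EB. b \<in> e}) \<le> 1"
    using card_mono[of "{{a,b}}" "{e\<in>EB. a \<in> e} \<inter> {e\<in>EB. b \<in> e}"] by simp
  with card_un have "card {e\<in>EB. a \<in> e} + card {e\<in>EB. b \<in> e} \<le> card EB + 1"
    using card_sum by linarith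
  then show ?thesis using split[OF ab(2)] split[OF ab(3)] 1 by (simp add: distrib_left)
qed

lemma cost_nonneg: "w \<in> B \<Longrightarrow> 0 \<le> d w * (1 - x w)"
  using x_le_1 B_subset by auto

lemma cost_pair_le:
  assumes "p \<in> B" "q \<in> B" "p \<noteq> q"
  shows "d p * (1 - x p) + d q * (1 - x q) \<le> (\<Sum>w\<in>B. d w * (1 - x w))"
proof -
  have "(\<Sum>w\<in>{p,q}. d w * (1 - x w)) \<le> (\<Sum>w\<in>B. d w * (1 - x w))"
    using assms finite_B cost_nonneg by (intro sum_mono2) auto
  then show ?thesis using assms(3) by simp
qed

text \<open>Two edges inside \<open>B\<close> leave at most 1/2 for the vertex costs, one edge
  leaves 3/2. The ends of such an edge have total weight at most about 1, so they cost about
  \<open>k\<close> or more if both have at least \<open>k\<close> neighbours in \<open>A\<close>;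
  this excludes \<open>k = 1\<close> for two edges and \<open>k = 2\<close> for one. What remains
  with zero or two edges is bipartite.\<close>

lemma one_edge_in_B:
  assumes nb: "\<not> bipartite G" and rho: "\<rho> \<ge> 159/10" and C: "card G - \<rho>^2 \<le> 5/2"
  obtains a b v where "EB = {{a,b}}" "a \<in> B" "b \<in> B" "a \<noteq> b"
    "nbrs G a \<inter> A = {v}" "nbrs G b \<inter> A \<noteq> {}"
proof -
  let ?C = "\<Sum>w\<in>B. d w * (1 - x w)"
  have C': "card EB + ?C \<le> 5/2" using C deficiency by simp
  have "?C \<ge> 0" using cost_nonneg by (intro sum_nonneg) auto
  then have "real (card EB) \<le> 5/2" using C' by linarith
  then have card2: "card EB \<le> 2" by linarith
  have d_pos: "d w \<ge> 1 \<longleftrightarrow> nbrs G w \<inter> A \<noteq> {}" for w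
    using finite_A card_gt_0_iff[of "nbrs G w \<inter> A"] by (auto simp: d_def Suc_le_eq)
  have both: "real k * (1 - (card EB + 1)/\<rho>) \<le> 5/2 - card EB"
    if pq: "{p,q} \<in> EB" and k: "k \<le> d p" "k \<le> d q" for p q k
  proof -
    have pqB: "p \<in> B" "q \<in> B" "p \<noteq> q" using pq edge_verts by (auto simp: EB_def)
    have x1: "x p \<le> 1" "x q \<le> 1" using pqB B_subset x_le_1 by auto
    have "x p + x q \<le> 1 + (card EB + 1)/\<rho>"
      using edge_in_B_sum[OF pq] rho by (simp add: field_simps)
    then have "k * (1 - (card EB + 1)/\<rho>) \<le> k * ((1 - x p) + (1 - x q))"
      by (intro mult_left_mono) auto
    also have "\<dots> \<le> d p * (1 - x p) + d q * (1 - x q)"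
      unfolding distrib_left using k x1 by (intro add_mono mult_right_mono) auto
    also have "\<dots> \<le> ?C" by (rule cost_pair_le[OF pqB])
    finally show ?thesis using C' by linarith
  qed
  have not2: "card EB \<noteq> 2"
  proof
    assume two: "card EB = 2"
    have free: "\<exists>p\<in>e. p \<in> B \<and> nbrs G p \<inter> A = {}" if e: "e \<in> EB" for e
    proof -
      have eG: "e \<in> G" "e \<subseteq> B" using e by (auto simp: EB_def)
      obtain p q where pq: "e = {p,q}" using edge_obtain[OF eG(1)] by blast
      have "\<not> (d p \<ge> 1 \<and> d q \<ge> 1)"
      proof
        assume "d p \<ge> 1 \<and> d q \<ge> 1"
        then have "1 - 3/\<rho> \<le> 1/2" using both[of p q 1] e pq two by simp
        then show False using rho by (simp add: field_simps)
      qed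
      then have "nbrs G p \<inter> A = {} \<or> nbrs G q \<inter> A = {}" unfolding d_pos by blast
      then show ?thesis using pq eG by blast
    qed
    obtain e1 e2 where EB: "EB = {e1,e2}" using two unfolding card_2_iff by blast
    then have e12: "e1 \<in> EB" "e2 \<in> EB" by simp_all
    obtain p1 where p1: "p1 \<in> e1" "p1 \<in> B" "nbrs G p1 \<inter> A = {}" using free[OF e12(1)] by blast
    obtain p2 where p2: "p2 \<in> e2" "p2 \<in> B" "nbrs G p2 \<inter> A = {}" using free[OF e12(2)] by blast
    have loop: "{p,p} \<notin> G" for p using edge_verts by blast
    have "bipartite G"
    \<comment> \<open>If the chosen ends are adjacent, one of the two edges is
      \<open>{p1,p2}\<close>, and a single end already covers both.\<close>
    proof (cases "{p1,p2} \<in> G")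
      case False
      then have "{p2,p1} \<notin> G" by (simp add: insert_commute)
      show ?thesis
      proof (rule bipartite_if_cover[of "{p1,p2}"])
        show "{v,w} \<notin> G" if "v \<in> {p1,p2}" "w \<in> {p1,p2}" for v w
          using that False \<open>{p2,p1} \<notin> G\<close> loop[of p1] loop[of p2] by blast
        show "e \<inter> {p1,p2} \<noteq> {}" if "e \<in> EB" for e
          using that p1(1) p2(1) unfolding EB by fast
      qed (use p1(2,3) p2(2,3) in auto)
    next
      case True
      then have "{p1,p2} \<in> EB" using p1 p2 by (simp add: EB_def)
      then consider "e1 = {p1,p2}" | "e2 = {p1,p2}" unfolding EB by fast
      then show ?thesis
      proof cases
        case 1
        show ?thesis
        proof (rule bipartite_if_cover[of "{p2}"])
          show "{v,w} \<notin> G" if "v \<in> {p2}" "w \<in> {p2}" for v w using that loop[of p2] by blast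
          show "e \<inter> {p2} \<noteq> {}" if "e \<in> EB" for e using that 1 p2(1) unfolding EB by fast
        qed (use p2(2,3) in auto)
      next
        case 2
        show ?thesis
        proof (rule bipartite_if_cover[of "{p1}"])
          show "{v,w} \<notin> G" if "v \<in> {p1}" "w \<in> {p1}" for v w using that loop[of p1] by blast
          show "e \<inter> {p1} \<noteq> {}" if "e \<in> EB" for e using that 2 p1(1) unfolding EB by fast
        qed (use p1(2,3) in auto)
      qed
    qed
    with nb show False by simp
  qed
  have "card EB \<noteq> 0"
  proof
    assume "card EB = 0"
    then have "bipartite G" using finite_EB by (intro bipartite_if_cover[of "{}"]) auto
    with nb show False by simp
  qed
  with not2 card2 have one: "card EB = 1" by simp
  then obtain e where EB: "EB = {e}" by (auto simp: card_1_singleton_iff)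
  then have e: "e \<in> G" "e \<subseteq> B" by (auto simp: EB_def)
  obtain p q where pq: "e = {p,q}" "p \<noteq> q" using edge_obtain[OF e(1)] by blast
  have ne: "nbrs G w \<inter> A \<noteq> {}" if "w \<in> e" for w
  proof
    assume "nbrs G w \<inter> A = {}"
    then have "bipartite G" using that e EB edge_verts[of w w]
      by (intro bipartite_if_cover[of "{w}"]) auto
    with nb show False by simp
  qed
  have "\<not> (2 \<le> d p \<and> 2 \<le> d q)"
  proof
    assume "2 \<le> d p \<and> 2 \<le> d q"
    then have "2 * (1 - 2/\<rho>) \<le> 3/2" using both[of p q 2] EB pq one by simp
    then show False using rho by (simp add: field_simps)
  qed
  then have "d p < 2 \<or> d q < 2" by linarith
  moreover have "e = {q,p}" "q \<noteq> p" using pq by auto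
  ultimately obtain a b where ab: "e = {a,b}" "a \<noteq> b" "d a < 2"
    using pq by blast
  then have "d a = 1" using d_pos[of a] ne[of a] by auto
  then obtain v where "nbrs G a \<inter> A = {v}" unfolding d_def by (auto simp: card_1_singleton_iff)
  moreover have "a \<in> B" "b \<in> B" "nbrs G b \<inter> A \<noteq> {}" using ab e ne[of b] by auto
  ultimately show ?thesis using that[of a b v] ab EB by blast
qed

end

section \<open>Near-complete bipartite structure\<close>

text \<open>A crude bound from which the sharper one below starts; \<open>X\<close> stands for
  \<open>x a\<close>, the other letters for the quantities defined in \<open>near_extremal\<close>.
  \<open>T > \<rho>\<close> would force \<open>E\<close> to be at least about
  \<open>1 / \<rho>\<close>, against \<open>(\<rho> - 3) * E \<le> 0.563\<close>.\<close>

lemma missing_weight_le_rho: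
  fixes \<rho> X E T D :: real
  assumes rho: "\<rho> \<ge> 159/10" and X: "\<rho> * X \<le> 2"
    and T: "T * (1 - E) \<le> \<rho> * (\<rho> * E + X)"
    and D: "D \<le> 563/1000" and E: "0 \<le> E" "(\<rho> - 3) * E \<le> D"
  shows "T \<le> \<rho>"
proof (rule ccontr)
  assume "\<not> T \<le> \<rho>"
  then have "T > \<rho>" by simp
  have E3: "(\<rho> - 3) * E \<le> 563/1000" using E D by simp
  have "12 * E \<le> (\<rho> - 3) * E" using rho E by (intro mult_right_mono) auto
  then have E1: "E < 1" using E3 by simp
  have "\<rho> * (1 - E) \<le> T * (1 - E)" using \<open>T > \<rho>\<close> E1 by (intro mult_right_mono) auto
  then have "\<rho> - 2 \<le> E * (\<rho>^2 + \<rho>)" using T X by (simp add: algebra_simps power2_eq_square)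
  then have "(\<rho> - 3) * (\<rho> - 2) \<le> (\<rho> - 3) * (E * (\<rho>^2 + \<rho>))" using rho by (intro mult_left_mono) auto
  also have "\<dots> = ((\<rho> - 3) * E) * (\<rho>^2 + \<rho>)" by simp
  also have "\<dots> \<le> 563/1000 * (\<rho>^2 + \<rho>)" using E3 rho by (intro mult_right_mono) auto
  finally have "(437/1000) * \<rho>^2 - (5563/1000) * \<rho> + 6 \<le> 0" by (simp add: algebra_simps power2_eq_square)
  moreover have "\<rho> * (159/10) \<le> \<rho> * \<rho>" using rho by (intro mult_left_mono) auto
  ultimately show False using rho by (simp add: power2_eq_square)
qed

text \<open>\<open>T \<le> \<rho>\<close> makes \<open>r\<close> small against \<open>n\<close>, so
  the bound on \<open>(n - r) * E\<close> makes \<open>E\<close> of order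
  \<open>s / \<rho>^2\<close> and \<open>T\<close> at most linear in \<open>s\<close>. The constants
  serve three later uses: \<open>T < 3\<close> at \<open>s = 2\<close>,
  \<open>T < 2 * (s - 1)\<close> for \<open>s \<ge> 3\<close>, and \<open>T < 4\<close> at
  \<open>s = 4\<close>.\<close>

lemma missing_weight_bound:
  fixes \<rho> X E T D n r s :: real
  assumes rho: "\<rho> \<ge> 159/10" and X0: "0 \<le> X" and X: "\<rho> * X \<le> 2" "\<rho> * X \<le> 1 + (s - 1 + X) / \<rho>"
    and T: "T * (1 - E) \<le> \<rho> * (\<rho> * E + X)" and s: "s \<ge> 2" and r: "r * (s - 1) \<le> T" "r \<ge> 0"
    and D: "D \<le> 563/1000" and E: "0 \<le> E" "(\<rho> - 3) * E \<le> D" "(n - r) * E \<le> D"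
    and n: "\<rho>^2 - 1 \<le> s * n"
  shows "T < 95/100 + 755/1000 * s" and "r < n"
proof -
  have T\<rho>: "T \<le> \<rho>" by (rule missing_weight_le_rho[OF rho X(1) T D E(1,2)])
  have rs: "s * r \<le> 2 * \<rho>"
  proof -
    have "s * r \<le> (2 * (s - 1)) * r" using s r by (intro mult_right_mono) auto
    also have "\<dots> \<le> 2 * \<rho>" using r T\<rho> by (simp add: algebra_simps)
    finally show ?thesis .
  qed
  have rr: "\<rho> * (159/10) \<le> \<rho>^2" using rho by (simp add: power2_eq_square)
  have nr: "\<rho>^2 - 1 - 2 * \<rho> \<le> s * (n - r)" using n rs by (simp add: algebra_simps)
  have "0 < s * (n - r)" using nr rr rho by linarith
  then show "r < n" using s by (simp add: zero_less_mult_iff)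
  \<comment> \<open>The margin of 0.69 over the bound 0.563 on \<open>D\<close> just absorbs the
    lower-order terms when \<open>\<rho> \<ge> 15.9\<close>.\<close>
  have "T - \<rho> * X \<le> 69/100 * s"
  proof (rule ccontr)
    assume *: "\<not> ?thesis"
    have "T - \<rho> * X \<le> E * (\<rho>^2 + T)" using T by (simp add: algebra_simps power2_eq_square)
    also have "\<dots> \<le> E * (\<rho>^2 + \<rho>)" using E T\<rho> by (intro mult_left_mono) auto
    finally have 1: "T - \<rho> * X \<le> E * (\<rho>^2 + \<rho>)" .
    have "(\<rho>^2 - 1 - 2 * \<rho>) * (69/100 * s) \<le> (s * (n - r)) * (T - \<rho> * X)"
      using nr * s rr rho by (intro mult_mono) auto
    also have "\<dots> \<le> (s * (n - r)) * (E * (\<rho>^2 + \<rho>))"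
      using 1 \<open>0 < s * (n - r)\<close> by (intro mult_left_mono) auto
    also have "\<dots> = s * ((n - r) * E) * (\<rho>^2 + \<rho>)" by simp
    also have "\<dots> \<le> s * (563/1000) * (\<rho>^2 + \<rho>)"
      using E D s rho by (intro mult_right_mono mult_left_mono) auto
    finally have "s * ((\<rho>^2 - 1 - 2 * \<rho>) * (69/100)) \<le> s * (563/1000 * (\<rho>^2 + \<rho>))"
      by (simp add: algebra_simps)
    then have "(\<rho>^2 - 1 - 2 * \<rho>) * (69/100) \<le> 563/1000 * (\<rho>^2 + \<rho>)" using s by simp
    then show False using rr rho by (simp add: algebra_simps)
  qed
  moreover have "\<rho> * X < 945/1000 + 65/1000 * s"
  proof -
    have "\<rho> * X \<ge> (159/10) * X" using rho X0 by (intro mult_right_mono) auto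
    then have "X \<le> 126/1000" using X by simp
    define z where "z = s - 1 + X"
    have "z / \<rho> \<le> z / (159/10)"
      using rho s X0 by (intro divide_left_mono) (auto simp: z_def)
    then have "159 * (z / \<rho>) \<le> 10 * z" by (simp add: mult.commute)
    moreover have "159 * (\<rho> * X) \<le> 159 + 159 * (z / \<rho>)" using X(2)[folded z_def] by linarith
    ultimately have "159 * (\<rho> * X) \<le> 159 + 10 * z" by linarith
    then show ?thesis using \<open>X \<le> 126/1000\<close> s by (simp add: z_def)
  qed
  ultimately show "T < 95/100 + 755/1000 * s" using s by simp
qed

text \<open>After elimination of \<open>X\<close> and \<open>E\<close> this is the positivity of a polynomial in \<open>\<rho>\<close> and \<open>s\<close>; it
  becomes a polynomial with positive coefficients in \<open>\<rho> - 159/10\<close>, \<open>s - 5\<close> and \<open>\<rho> + 1/10 - s\<close>.\<close>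

lemma no_large_side:
  fixes \<rho> X E D n s :: real
  assumes rho: "\<rho> \<ge> 159/10" and X: "X * (\<rho>^2 - 1) \<le> \<rho> + s - 1" "\<rho> * X \<le> 2"
    and T: "(s - 1) * (1 - E) \<le> \<rho> * (\<rho> * E + X)" and s: "s \<ge> 5" "s \<le> \<rho> + 1/10"
    and D0: "D \<le> 1/2 - 1 / (\<rho> - 1) + X" and E: "(n - 1) * E \<le> D"
    and n: "\<rho>^2 - 1 \<le> s * n"
  shows False
proof -
  define p q w where "p = s - 5" and "q = \<rho> - 159/10" and "w = 11 + q - p"
  define c where "c = 1 / (\<rho> - 1)"
  have D: "D \<le> 1/2 - c + X" using D0 by (simp add: c_def)
  have c: "(\<rho>^2 - 1) * c = \<rho> + 1" using rho by (simp add: c_def field_simps power2_eq_square)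
  have pqw: "p \<ge> 0" "q \<ge> 0" "w \<ge> 0" "s = 5 + p" "\<rho> = 159/10 + q"
    using rho s by (auto simp: p_def q_def w_def)
  have rr: "\<rho> * (159/10) \<le> \<rho>^2" using rho by (simp add: power2_eq_square)
  have 1: "s - 1 - \<rho> * X \<le> E * (\<rho>^2 + s - 1)" using T by (simp add: algebra_simps power2_eq_square)
  have ns: "\<rho>^2 - 1 - s \<le> s * (n - 1)" using n by (simp add: algebra_simps)
  have ns0: "0 \<le> \<rho>^2 - 1 - s" using rr rho s by linarith
  \<comment> \<open>Eliminates \<open>E\<close>: its lower bound from \<open>1\<close> is multiplied
    by \<open>s * (n - 1)\<close>, and \<open>(n - 1) * E \<le> D\<close>.\<close>
  have "(\<rho>^2 - 1 - s) * (s - 1 - \<rho> * X) \<le> (s * (n - 1)) * (s - 1 - \<rho> * X)"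
    using ns s X by (intro mult_right_mono) auto
  also have "\<dots> \<le> (s * (n - 1)) * (E * (\<rho>^2 + s - 1))"
    using 1 ns ns0 by (intro mult_left_mono) auto
  also have "\<dots> = s * ((n - 1) * E) * (\<rho>^2 + s - 1)" by simp
  also have "\<dots> \<le> s * (1/2 - c + X) * (\<rho>^2 + s - 1)"
    using E D s rr rho by (intro mult_right_mono mult_left_mono) auto
  finally have 2: "(\<rho>^2 - 1 - s) * (s - 1 - \<rho> * X) \<le> s * (1/2 - c + X) * (\<rho>^2 + s - 1)" .
  have r1: "\<rho>^2 - 1 > 0" using rr rho by linarith
  have spos: "0 \<le> s * (\<rho>^2 + s - 1)" using s r1 by (intro mult_nonneg_nonneg) linarith+
  \<comment> \<open>Multiplying by \<open>\<rho>^2 - 1\<close> lets \<open>X\<close> be replaced by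
    its upper bound on both sides and turns \<open>c\<close> into a polynomial.\<close>
  have "(\<rho>^2 - 1 - s) * ((s - 1) * (\<rho>^2 - \<rho> - 1) - \<rho>^2)
      = (\<rho>^2 - 1 - s) * ((s - 1) * (\<rho>^2 - 1) - \<rho> * (\<rho> + s - 1))"
    by (simp add: algebra_simps power2_eq_square)
  also have "\<dots> \<le> (\<rho>^2 - 1 - s) * ((s - 1) * (\<rho>^2 - 1) - \<rho> * (X * (\<rho>^2 - 1)))"
    using X(1) ns0 rho by (intro mult_left_mono diff_left_mono) auto
  also have "\<dots> = ((\<rho>^2 - 1 - s) * (s - 1 - \<rho> * X)) * (\<rho>^2 - 1)"
    by (simp add: algebra_simps)
  also have "\<dots> \<le> (s * (1/2 - c + X) * (\<rho>^2 + s - 1)) * (\<rho>^2 - 1)"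
    using 2 r1 by (intro mult_right_mono) auto
  also have "\<dots> = s * (\<rho>^2 + s - 1) * ((\<rho>^2 - 1)/2 - (\<rho>^2 - 1) * c + X * (\<rho>^2 - 1))"
    by (simp add: algebra_simps add_divide_distrib diff_divide_distrib)
  also note c
  also have "s * (\<rho>^2 + s - 1) * ((\<rho>^2 - 1)/2 - (\<rho> + 1) + X * (\<rho>^2 - 1))
      \<le> s * (\<rho>^2 + s - 1) * ((\<rho>^2 - 1)/2 - (\<rho> + 1) + (\<rho> + s - 1))"
    using X(1) spos by (intro mult_left_mono add_left_mono) auto
  also have "\<dots> = s * (\<rho>^2 + s - 1) * ((\<rho>^2 - 5)/2 + s)" by (simp add: field_simps)
  finally have "(\<rho>^2 - 1 - s) * ((s - 1) * (\<rho>^2 - \<rho> - 1) - \<rho>^2)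
      - s * (\<rho>^2 + s - 1) * ((\<rho>^2 - 5)/2 + s) \<le> 0" by simp
  moreover have "(\<rho>^2 - 1 - s) * ((s - 1) * (\<rho>^2 - \<rho> - 1) - \<rho>^2)
      - s * (\<rho>^2 + s - 1) * ((\<rho>^2 - 5)/2 + s)
    = (99665741/20000 + 1807269/500 * q + 52313/100 * q^2 + 139/5 * q^3 + 1/2 * q^4)
      + p * (309751481/20000 + 5079203/1000 * q + 58173/100 * q^2 + 283/10 * q^3 + 1/2 * q^4)
      + p * w * (5101/8 + 159/2 * q + 5/2 * q^2 + p)"
    unfolding pqw(4,5) w_def by (simp add: field_simps power2_eq_square power3_eq_cube power4_eq_xxxx)
  moreover have "\<dots> > 0" using pqw by (intro add_pos_nonneg mult_nonneg_nonneg add_nonneg_nonneg) auto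
  ultimately show False by simp
qed

text \<open>Keeps the shape of \<open>L_graph\<close> out of the comparison with
  \<open>Y_graph\<close> and \<open>T_graph\<close>: for \<open>s = r = 2\<close>, a deficiency of
  at most 7/3 means \<open>D \<le> 1/3 + X\<close>. Eliminating \<open>E\<close> and
  \<open>X\<close> leaves \<open>\<rho>^2 - 12 * \<rho> + 8 \<le> 0\<close>.\<close>

lemma no_pendant_type:
  fixes \<rho> X E D n :: real
  assumes rho: "\<rho> \<ge> 159/10" and X: "X * (\<rho>^2 - 1) \<le> \<rho> + 1"
    and T: "2 * (1 - E) \<le> \<rho> * (\<rho> * E + X)"
    and D: "D \<le> 1/3 + X" and E: "(n - 2) * E \<le> D"
    and n: "\<rho>^2 \<le> 2 * n"
  shows False
proof -
  have rr: "\<rho> * (159/10) \<le> \<rho>^2" using rho by (simp add: power2_eq_square)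
  have "\<rho>^2 - 1 = (\<rho> + 1) * (\<rho> - 1)" by (simp add: algebra_simps power2_eq_square)
  then have "(\<rho> + 1) * (X * (\<rho> - 1)) \<le> (\<rho> + 1) * 1" using X by (simp add: mult.commute mult.left_commute)
  then have X1: "X * (\<rho> - 1) \<le> 1" using rho by (simp only: mult_le_cancel_left_pos)
  have 1: "2 - \<rho> * X \<le> E * (\<rho>^2 + 2)" using T by (simp add: algebra_simps power2_eq_square)
  have n2: "(n - 2) \<ge> 0" using n rr rho by linarith
  have "(\<rho> - 2) * (\<rho>^2 - 4) \<le> (\<rho> - 2) * (2 * (n - 2))"
    using n rho by (intro mult_left_mono) auto
  also have "\<dots> = (2 * (\<rho> - 1) - \<rho> * 1) * (2 * (n - 2))" by simp
  also have "\<dots> \<le> (2 * (\<rho> - 1) - \<rho> * (X * (\<rho> - 1))) * (2 * (n - 2))"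
    using X1 rho n2 by (intro mult_right_mono diff_left_mono mult_left_mono) auto
  also have "\<dots> = 2 * (\<rho> - 1) * ((n - 2) * (2 - \<rho> * X))" by (simp add: algebra_simps)
  also have "\<dots> \<le> 2 * (\<rho> - 1) * ((n - 2) * (E * (\<rho>^2 + 2)))"
    using 1 n2 rho by (intro mult_left_mono) auto
  also have "\<dots> = 2 * (\<rho>^2 + 2) * ((\<rho> - 1) * ((n - 2) * E))" by (simp add: algebra_simps)
  also have "\<dots> \<le> 2 * (\<rho>^2 + 2) * ((\<rho> - 1) * (1/3 + X))"
    using E D rho by (intro mult_left_mono) auto
  also have "(\<rho> - 1) * (1/3 + X) = (\<rho> - 1)/3 + X * (\<rho> - 1)" by (simp add: algebra_simps)
  also have "2 * (\<rho>^2 + 2) * ((\<rho> - 1)/3 + X * (\<rho> - 1)) \<le> 2 * (\<rho>^2 + 2) * ((\<rho> - 1)/3 + 1)"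
    using X1 by (intro mult_left_mono add_left_mono) auto
  finally have "3 * ((\<rho> - 2) * (\<rho>^2 - 4)) \<le> 3 * (2 * (\<rho>^2 + 2) * ((\<rho> - 1)/3 + 1))" by simp
  moreover have "3 * ((\<rho> - 2) * (\<rho>^2 - 4)) = (\<rho> + 2) * (3 * (\<rho> - 2)^2)"
    by (simp add: algebra_simps power2_eq_square)
  moreover have "3 * (2 * (\<rho>^2 + 2) * ((\<rho> - 1)/3 + 1)) = (\<rho> + 2) * (2 * (\<rho>^2 + 2))"
    by (simp add: field_simps)
  ultimately have "(\<rho> + 2) * (3 * (\<rho> - 2)^2) \<le> (\<rho> + 2) * (2 * (\<rho>^2 + 2))" by (simp only:)
  then have "3 * (\<rho> - 2)^2 \<le> 2 * (\<rho>^2 + 2)" using rho by (simp only: mult_le_cancel_left_pos)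
  then have "\<rho>^2 - 12 * \<rho> + 8 \<le> 0" by (simp add: algebra_simps power2_eq_square)
  then show False using rr rho by linarith
qed


text \<open>The bound \<open>cost\<close> is what reaching the radius of \<open>L_graph\<close>
  yields; a deficiency of at most 7/3 gives even more.\<close>

locale near_extremal = perron_vertex G x \<rho> u
  for G :: "'a set set" and x :: "'a \<Rightarrow> real" and \<rho> :: real and u :: 'a +
  fixes a b v :: 'a
  assumes EB_eq: "EB = {{a,b}}" and a_in_B: "a \<in> B" and b_in_B: "b \<in> B" and a_neq_b: "a \<noteq> b"
    and nbrs_a_Int_A: "nbrs G a \<inter> A = {v}" and nbrs_b_Int_A: "nbrs G b \<inter> A \<noteq> {}"
    and rho: "\<rho> \<ge> 159/10" and cost: "card G - \<rho>^2 \<le> 5/2 - 1 / (\<rho> - 1)"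
begin

text \<open>The graph is a near-complete bipartite graph between \<open>A\<close> and \<open>insert u W\<close>, together with
  the path \<open>v - a - b\<close>; \<open>miss\<close> records the non-edges of the bipartite graph.\<close>

definition W where "W = B - {a}"
definition miss where "miss j = {w\<in>W. w \<notin> nbrs G j}"
definition J where "J = {j\<in>A. miss j \<noteq> {}}"
definition s where "s = card W + 1"
definition n where "n = card A"
definition r where "r = card J"
definition k where "k j = card (miss j)"
definition T where "T = (\<Sum>j\<in>A. k j * (s - k j))"
definition E where "E = (\<Sum>w\<in>W. 1 - x w)"
definition D where "D = card G - \<rho>^2 - 2 + x a"

section \<open>Local eigenvalue equations and the bounds they imply\<close>

lemma finite_W: "finite W" and finite_J: "finite J" and finite_miss: "finite (miss j)"
  using finite_B finite_A by (auto simp: W_def J_def miss_def)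

lemma W_verts: "w \<in> W \<Longrightarrow> w \<in> verts G" and a_verts: "a \<in> verts G"
  using B_subset a_in_B by (auto simp: W_def)

lemma b_in_W: "b \<in> W"
  using b_in_B a_neq_b by (simp add: W_def)

lemma edge_ab: "{a,b} \<in> G"
  using EB_eq by (auto simp: EB_def)

lemma v_in_A: "v \<in> A" and v_adj_a: "v \<in> nbrs G a"
  using nbrs_a_Int_A by auto

lemma v_notin_nbrs_b: "v \<notin> nbrs G b"
  using no_triangle[of v a b] v_adj_a edge_ab nbrs_commute[of v G b]
  by (auto simp: nbrs_def insert_commute)

lemma nbrs_Int_B: "w \<in> B \<Longrightarrow> nbrs G w \<inter> B = (if w = a then {b} else if w = b then {a} else {})"
proof -
  assume w: "w \<in> B"
  have "{p,w} = {a,b}" if "p \<in> nbrs G w \<inter> B" for p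
  proof -
    have "{p,w} \<in> EB" using that w by (auto simp: EB_def nbrs_def)
    then show ?thesis using EB_eq by simp
  qed
  then have "nbrs G w \<inter> B \<subseteq> (if w = a then {b} else if w = b then {a} else {})"
    by (auto simp: doubleton_eq_iff)
  moreover have "b \<in> nbrs G a" "a \<in> nbrs G b" using edge_ab by (auto simp: nbrs_def insert_commute)
  ultimately show ?thesis using a_in_B b_in_B by (auto split: if_splits)
qed

lemma rho_x_a: "\<rho> * x a = x v + x b"
proof -
  have "nbrs G a = {v,b}" using nbrs_of_B[OF a_in_B] nbrs_Int_B[OF a_in_B] nbrs_a_Int_A by auto
  moreover have "v \<noteq> b" using v_in_A b_in_B A_Int_B by blast
  ultimately show ?thesis using eigen[OF a_verts] by simp
qed

lemma rho_x_W:
  assumes w: "w \<in> W"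
  shows "\<rho> * x w = (\<Sum>j\<in>nbrs G w \<inter> A. x j) + (if w = b then x a else 0)"
proof -
  have wB: "w \<in> B" "w \<noteq> a" using w by (auto simp: W_def)
  have "nbrs G w = (nbrs G w \<inter> A) \<union> (if w = b then {a} else {})"
    using nbrs_of_B[OF wB(1)] nbrs_Int_B[OF wB(1)] wB(2) by simp
  then have "\<rho> * x w = (\<Sum>j\<in>(nbrs G w \<inter> A) \<union> (if w = b then {a} else {}). x j)"
    using eigen[OF W_verts[OF w]] by simp
  also have "\<dots> = (\<Sum>j\<in>nbrs G w \<inter> A. x j) + (\<Sum>j\<in>(if w = b then {a} else {}). x j)"
    using finite_A A_Int_B a_in_B by (intro sum.union_disjoint) auto
  finally show ?thesis by simp
qed

lemma rho_x_A:
  assumes j: "j \<in> A"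
  shows "\<rho> * x j = 1 + (\<Sum>w\<in>W - miss j. x w) + (if j = v then x a else 0)"
proof -
  have "a \<in> nbrs G j \<longleftrightarrow> j = v" using j nbrs_a_Int_A nbrs_commute[of a G j] by blast
  then have "nbrs G j \<inter> B = (W - miss j) \<union> (if j = v then {a} else {})"
    using a_in_B by (auto simp: W_def miss_def)
  then have nb: "nbrs G j = insert u ((W - miss j) \<union> (if j = v then {a} else {}))"
    using nbrs_of_A[OF j] by simp
  have "\<rho> * x j = (\<Sum>w\<in>nbrs G j. x w)" using eigen j A_subset by auto
  also have "\<dots> = x u + (\<Sum>w\<in>(W - miss j) \<union> (if j = v then {a} else {}). x w)"
    unfolding nb using finite_W u_notin_B a_in_B by (intro sum.insert) (auto simp: W_def)
  also have "(\<Sum>w\<in>(W - miss j) \<union> (if j = v then {a} else {}). x w)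
      = (\<Sum>w\<in>W - miss j. x w) + (\<Sum>w\<in>(if j = v then {a} else {}). x w)"
    using finite_W by (intro sum.union_disjoint) (auto simp: W_def)
  finally show ?thesis by (simp add: x_u)
qed

lemma x_W: "w \<in> W \<Longrightarrow> 0 \<le> x w \<and> x w \<le> 1"
  using W_verts x_nonneg x_le_1 by blast

lemma x_a_nonneg: "0 \<le> x a"
  using x_nonneg[OF a_verts] .

lemma E_nonneg: "0 \<le> E"
  unfolding E_def using x_W by (intro sum_nonneg) auto

lemma defect_le_E: "w \<in> W \<Longrightarrow> 1 - x w \<le> E"
  unfolding E_def using x_W finite_W by (intro member_le_sum) auto

lemma k_le: "k j < s"
  using card_mono[OF finite_W, of "miss j"] by (auto simp: k_def s_def miss_def less_Suc_eq_le)

lemma k_pos_iff: "j \<in> A \<Longrightarrow> k j \<ge> 1 \<longleftrightarrow> j \<in> J"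
  using finite_miss[of j] card_gt_0_iff[of "miss j"] by (auto simp: k_def J_def Suc_le_eq)

lemma v_in_J: "v \<in> J" and b_in_miss_v: "b \<in> miss v"
  using v_notin_nbrs_b v_in_A b_in_W nbrs_commute[of b G v] by (auto simp: J_def miss_def)

lemma r_pos: "r \<ge> 1"
  using v_in_J finite_J card_gt_0_iff[of J] by (auto simp: r_def Suc_le_eq)

lemma s_ge_2: "s \<ge> 2"
  using b_in_W finite_W card_gt_0_iff[of W] by (auto simp: s_def Suc_le_eq)

text \<open>\<open>v\<close> misses \<open>b\<close>, so besides \<open>u\<close> and
  \<open>a\<close> it has at most \<open>s - 2\<close> neighbours.\<close>

lemma x_v_bound: "\<rho> * x v \<le> real s - 1 + x a"
proof -
  have "(\<Sum>w\<in>W - miss v. x w) \<le> (\<Sum>w\<in>W - miss v. 1)" using x_W by (intro sum_mono) auto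
  also have "\<dots> = card (W - miss v)" by simp
  also have "card (W - miss v) \<le> card (W - {b})"
    using b_in_miss_v finite_W by (intro card_mono) auto
  also have "card (W - {b}) = card W - 1" using b_in_W by simp
  finally have "(\<Sum>w\<in>W - miss v. x w) \<le> real (card W - 1)" by simp
  moreover have "real (card W - 1) = real s - 2" using s_ge_2 by (simp add: s_def of_nat_diff)
  ultimately show ?thesis using rho_x_A[OF v_in_A] by simp
qed

lemma x_a_bounds:
  shows "\<rho> * x a \<le> 2" and "\<rho> * x a \<le> 1 + (real s - 1 + x a) / \<rho>" and "x a * (\<rho>^2 - 1) \<le> \<rho> + real s - 1"
proof -
  have "x v \<le> 1" "x b \<le> 1" using x_le_1 v_in_A A_subset x_W[OF b_in_W] by auto
  then show "\<rho> * x a \<le> 2" using rho_x_a by simp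
  have "x v \<le> (real s - 1 + x a) / \<rho>" using x_v_bound rho by (simp add: field_simps)
  then show *: "\<rho> * x a \<le> 1 + (real s - 1 + x a) / \<rho>" using rho_x_a \<open>x b \<le> 1\<close> by simp
  have "\<rho> * (\<rho> * x a) \<le> \<rho> * (1 + (real s - 1 + x a) / \<rho>)" using * rho by (intro mult_left_mono) auto
  also have "\<dots> = \<rho> + (real s - 1 + x a)" using rho by (simp add: field_simps)
  finally show "x a * (\<rho>^2 - 1) \<le> \<rho> + real s - 1" by (simp add: algebra_simps power2_eq_square)
qed

text \<open>The number 0.563 covers \<open>1/2 + 1 / \<rho>\<close> at \<open>\<rho> = 15.9\<close>:
  \<open>x a\<close> adds at most \<open>2 / \<rho>\<close>, and \<open>1 / (\<rho> - 1)\<close>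
  takes back at least \<open>1 / \<rho>\<close>.\<close>

lemma D_le: "D \<le> 1/2 - 1 / (\<rho> - 1) + x a" and D_le_num: "D \<le> 563/1000"
proof -
  show *: "D \<le> 1/2 - 1 / (\<rho> - 1) + x a" using cost by (simp add: D_def)
  have "x a \<le> 2 / \<rho>" using x_a_bounds(1) rho by (simp add: field_simps)
  moreover have "1 / \<rho> \<le> 1 / (\<rho> - 1)" using rho by (intro divide_left_mono) auto
  moreover have "1 / \<rho> \<le> 1 / (159/10)" using rho by (intro divide_left_mono) auto
  ultimately show "D \<le> 563/1000" using * by simp
qed

text \<open>Of the deficiency, the edge \<open>{a,b}\<close> accounts for 1 and the vertex
  \<open>a\<close>, with its single neighbour in \<open>A\<close>, for \<open>1 - x a\<close>;
  \<open>D\<close> is what is left for \<open>W\<close>.\<close>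

lemma D_eq: "D = (\<Sum>w\<in>W. d w * (1 - x w))"
proof -
  have "(\<Sum>w\<in>B. d w * (1 - x w)) = d a * (1 - x a) + (\<Sum>w\<in>W. d w * (1 - x w))"
    unfolding W_def using finite_B a_in_B by (rule sum.remove)
  moreover have "d a = 1" using nbrs_a_Int_A by (simp add: d_def)
  moreover have "card EB = 1" using EB_eq by simp
  ultimately show ?thesis using deficiency by (simp add: D_def)
qed

lemma D_ge_if_degree_ge:
  fixes c :: real
  assumes "\<And>w. w \<in> W \<Longrightarrow> c \<le> d w"
  shows "c * E \<le> D"
  unfolding D_eq E_def sum_distrib_left using assms x_W by (intro sum_mono mult_right_mono) auto

lemma d_pos: "w \<in> W \<Longrightarrow> d w \<ge> 1"
proof -
  assume w: "w \<in> W"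
  then have wB: "w \<in> B" "w \<noteq> a" by (auto simp: W_def)
  have "nbrs G w \<inter> A \<noteq> {}"
  proof (cases "w = b")
    case False
    then have "nbrs G w = nbrs G w \<inter> A" using nbrs_of_B[OF wB(1)] nbrs_Int_B[OF wB(1)] wB(2) by simp
    moreover have "nbrs G w \<noteq> {}" using W_verts[OF w] verts_iff_nbrs[OF simple] by blast
    ultimately show ?thesis by simp
  qed (use nbrs_b_Int_A in simp)
  then show ?thesis using finite_A card_gt_0_iff[of "nbrs G w \<inter> A"] by (auto simp: d_def Suc_le_eq)
qed

text \<open>The weight of \<open>w\<close> is at most \<open>(d w + 1) / \<rho>\<close>, so its cost
  is at least \<open>d w * (\<rho> - 1 - d w) / \<rho>\<close>. For \<open>d w\<close> between 1 and
  \<open>\<rho> - 3\<close> this exceeds \<open>D\<close>.\<close>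

lemma d_ge_rho:
  assumes w: "w \<in> W"
  shows "\<rho> - 3 \<le> d w"
proof (rule ccontr)
  assume small: "\<not> ?thesis"
  have "(\<Sum>j\<in>nbrs G w \<inter> A. x j) \<le> (\<Sum>j\<in>nbrs G w \<inter> A. 1)"
    using x_le_1 A_subset by (intro sum_mono) auto
  moreover have "x a \<le> 1" using x_le_1[OF a_verts] .
  ultimately have "\<rho> * x w \<le> d w + 1" using rho_x_W[OF w] by (auto simp: d_def split: if_splits)
  then have "d w * (\<rho> - 1 - d w) \<le> d w * (\<rho> * (1 - x w))"
    by (intro mult_left_mono) (auto simp: algebra_simps)
  also have "\<dots> = \<rho> * (d w * (1 - x w))" by simp
  also have "d w * (1 - x w) \<le> D"
    unfolding D_eq using x_W w finite_W by (intro member_le_sum) auto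
  also have "D \<le> 563/1000" by (rule D_le_num)
  finally have *: "d w * (\<rho> - 1 - d w) \<le> \<rho> * (563/1000)" using rho by simp
  \<comment> \<open>Concavity in \<open>d w\<close>: the product lies above the chord
    \<open>\<rho> - 3 + d w\<close> through its values at 1 and \<open>\<rho> - 3\<close>.\<close>
  have "0 \<le> (real (d w) - 1) * (\<rho> - 3 - d w)" using d_pos[OF w] small by (intro mult_nonneg_nonneg) auto
  then have "\<rho> - 3 + real (d w) \<le> d w * (\<rho> - 1 - d w)" by (simp add: algebra_simps)
  then show False using * rho d_pos[OF w] by simp
qed

lemma d_ge_n: 
  assumes w: "w \<in> W"
  shows "real n - r \<le> d w"
proof -
  have "A - nbrs G w \<subseteq> J" using w nbrs_commute[of w G] by (auto simp: J_def miss_def)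
  then have "A \<subseteq> (nbrs G w \<inter> A) \<union> J" by blast
  then have "n \<le> card ((nbrs G w \<inter> A) \<union> J)" unfolding n_def using finite_A finite_J by (intro card_mono) auto
  also have "\<dots> \<le> d w + r" unfolding d_def r_def by (rule card_Un_le)
  finally show ?thesis by simp
qed

text \<open>\<open>A\<close> has total weight \<open>\<rho>\<close>, so
  \<open>\<rho> * (1 - x w)\<close> is the weight of the vertices of \<open>A\<close> not adjacent
  to \<open>w\<close>, less \<open>x a\<close> if \<open>w = b\<close>. Summing over
  \<open>W\<close> counts every missing edge once, with the weight of its end in
  \<open>A\<close>.\<close>

lemma rho_E: "\<rho> * E + x a = (\<Sum>j\<in>A. k j * x j)"
proof -
  have "\<rho> * E = (\<Sum>w\<in>W. (\<Sum>j\<in>A. if w \<in> miss j then x j else 0) - (if w = b then x a else 0))"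
    unfolding E_def sum_distrib_left
  proof (rule sum.cong[OF refl])
    fix w assume w: "w \<in> W"
    have "\<rho> = (\<Sum>j\<in>A \<inter> nbrs G w. x j) + (\<Sum>j\<in>A - nbrs G w. x j)"
      unfolding sum_A[symmetric] using finite_A by (rule sum.Int_Diff)
    moreover have "A - nbrs G w = {j\<in>A. w \<in> miss j}"
      using w nbrs_commute[of w G] by (auto simp: miss_def)
    moreover have "(\<Sum>j\<in>{j\<in>A. w \<in> miss j}. x j) = (\<Sum>j\<in>A. if w \<in> miss j then x j else 0)"
      using finite_A by (rule sum.inter_filter)
    ultimately show "\<rho> * (1 - x w) = (\<Sum>j\<in>A. if w \<in> miss j then x j else 0) - (if w = b then x a else 0)"
      using rho_x_W[OF w] by (simp add: Int_commute right_diff_distrib)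
  qed
  also have "\<dots> = (\<Sum>w\<in>W. \<Sum>j\<in>A. if w \<in> miss j then x j else 0) - x a"
    using finite_W b_in_W by (simp add: sum_subtractf)
  also have "(\<Sum>w\<in>W. \<Sum>j\<in>A. if w \<in> miss j then x j else 0) = (\<Sum>j\<in>A. \<Sum>w\<in>W. if w \<in> miss j then x j else 0)"
    by (rule sum.swap)
  also have "\<dots> = (\<Sum>j\<in>A. k j * x j)"
  proof (rule sum.cong[OF refl])
    fix j
    have "(\<Sum>w\<in>W. if w \<in> miss j then x j else 0) = (\<Sum>w\<in>W \<inter> miss j. x j)"
      using finite_W by (rule sum.inter_restrict[symmetric])
    moreover have "W \<inter> miss j = miss j" by (auto simp: miss_def)
    ultimately show "(\<Sum>w\<in>W. if w \<in> miss j then x j else 0) = k j * x j" by (simp add: k_def)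
  qed
  finally show ?thesis by simp
qed

text \<open>A vertex \<open>j\<close> of \<open>A\<close> keeps \<open>s - k j\<close> neighbours in
  \<open>insert u W\<close>, each of weight at least \<open>1 - E\<close>. This bounds
  \<open>\<rho> * x j\<close> from below and is inserted into \<open>rho_E\<close>.\<close>

lemma T_le: "T * (1 - E) \<le> \<rho> * (\<rho> * E + x a)"
proof -
  have "T * (1 - E) = (\<Sum>j\<in>A. k j * (real (s - k j) * (1 - E)))"
    by (simp add: T_def sum_distrib_right mult.assoc)
  also have "\<dots> \<le> (\<Sum>j\<in>A. k j * (\<rho> * x j))"
  proof (intro sum_mono mult_left_mono)
    fix j assume j: "j \<in> A"
    have "card (W - miss j) = card W - k j"
      unfolding k_def by (intro card_Diff_subset finite_miss) (auto simp: miss_def)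
    then have "real (s - k j) = 1 + card (W - miss j)" using k_le[of j] by (simp add: s_def)
    then have "real (s - k j) * (1 - E) = (1 - E) + (\<Sum>w\<in>W - miss j. 1 - E)" by (simp add: algebra_simps)
    also have "\<dots> \<le> 1 + (\<Sum>w\<in>W - miss j. x w)"
      using E_nonneg defect_le_E by (intro add_mono sum_mono) (auto simp: algebra_simps)
    also have "\<dots> \<le> \<rho> * x j" using rho_x_A[OF j] x_a_nonneg by simp
    finally show "real (s - k j) * (1 - E) \<le> \<rho> * x j" .
  qed simp
  also have "\<dots> = \<rho> * (\<Sum>j\<in>A. k j * x j)" by (simp add: sum_distrib_left mult_ac)
  finally show ?thesis by (simp add: rho_E)
qed

text \<open>Double counting of the missing edges. The 2 stands for the edges \<open>{v,a}\<close>
  and \<open>{a,b}\<close>, which lie outside the bipartite graph between \<open>A\<close> and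
  \<open>insert u W\<close>.\<close>

lemma card_G_eq: "card G + (\<Sum>j\<in>A. k j) = s * n + 2"
proof -
  have dk: "d w + card (A - nbrs G w) = n" for w
    using card_Diff_subset_Int[of A "nbrs G w"] card_mono[OF finite_A, of "A \<inter> nbrs G w"] finite_A
    by (simp add: d_def n_def Int_commute)
  have "(\<Sum>j\<in>A. k j) = (\<Sum>j\<in>A. \<Sum>w\<in>W. if w \<in> miss j then 1 else 0)"
  proof (rule sum.cong[OF refl])
    fix j
    have "W \<inter> miss j = miss j" by (auto simp: miss_def)
    then show "k j = (\<Sum>w\<in>W. if w \<in> miss j then 1 else 0)"
      unfolding k_def using finite_W by (simp add: sum.inter_restrict[symmetric])
  qed
  also have "\<dots> = (\<Sum>w\<in>W. \<Sum>j\<in>A. if w \<in> miss j then 1 else 0)" by (rule sum.swap)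
  also have "\<dots> = (\<Sum>w\<in>W. card (A - nbrs G w))"
  proof (rule sum.cong[OF refl])
    fix w assume w: "w \<in> W"
    have "A - nbrs G w = {j\<in>A. w \<in> miss j}"
      using w nbrs_commute[of w G] by (auto simp: miss_def)
    then show "(\<Sum>j\<in>A. if w \<in> miss j then 1 else 0) = card (A - nbrs G w)"
      using finite_A by (simp add: sum.inter_filter[symmetric])
  qed
  finally have "(\<Sum>w\<in>W. d w) + (\<Sum>j\<in>A. k j) = (\<Sum>w\<in>W. n)"
    using dk by (simp add: sum.distrib[symmetric])
  moreover have "(\<Sum>w\<in>B. d w) = d a + (\<Sum>w\<in>W. d w)"
    unfolding W_def using finite_B a_in_B by (rule sum.remove)
  moreover have "d a = 1" using nbrs_a_Int_A by (simp add: d_def)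
  moreover have "card EB = 1" using EB_eq by simp
  ultimately show ?thesis using card_edges by (simp add: s_def n_def)
qed

lemma sum_over_J: "(\<Sum>j\<in>A. k j * f j) = (\<Sum>j\<in>J. k j * f j)" for f :: "'a \<Rightarrow> nat"
  using finite_A k_pos_iff by (intro sum.mono_neutral_right) (auto simp: J_def k_def)

lemma r_le_sum_k: "r \<le> (\<Sum>j\<in>A. k j)" and T_ge: "r * (s - 1) \<le> T"
proof -
  have kJ: "1 \<le> k j" "k j < s" if "j \<in> J" for j using that k_pos_iff k_le by (auto simp: J_def)
  have "(\<Sum>j\<in>J. 1) \<le> (\<Sum>j\<in>J. k j * 1)" using kJ by (intro sum_mono) auto
  then show "r \<le> (\<Sum>j\<in>A. k j)" using sum_over_J[of "\<lambda>_. 1"] by (simp add: r_def)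
  have "(\<Sum>j\<in>J. s - 1) \<le> (\<Sum>j\<in>J. k j * (s - k j))"
  proof (rule sum_mono)
    fix j assume "j \<in> J"
    then have "1 \<le> k j" "k j < s" using kJ by auto
    \<comment> \<open>In these terms the claim is \<open>p + q + 1 \<le> (p + 1) * (q + 1)\<close>,
      free of truncated subtraction.\<close>
    then obtain p q where "k j = Suc p" "s = Suc (k j + q)"
      using less_imp_Suc_add[of "k j" s] by (cases "k j") auto
    then show "s - 1 \<le> k j * (s - k j)" by simp
  qed
  then show "r * (s - 1) \<le> T" using sum_over_J[of "\<lambda>j. s - k j"] by (simp add: T_def r_def)
qed

lemma sn_ge: "\<rho>^2 - 1 \<le> real s * n"
proof -
  have "0 \<le> (\<Sum>w\<in>B. d w * (1 - x w))" using cost_nonneg by (intro sum_nonneg) auto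
  then have "\<rho>^2 \<le> card G" using deficiency by simp
  moreover have "real (card G) + real (\<Sum>j\<in>A. k j) = real s * n + 2"
    using arg_cong[OF card_G_eq, of real] by simp
  moreover have "real 1 \<le> real (\<Sum>j\<in>A. k j)"
    by (rule of_nat_mono[OF order_trans[OF r_pos r_le_sum_k]])
  ultimately show ?thesis by simp
qed

lemma T_upper: "T < 95/100 + 755/1000 * s" and r_less_n: "r < n"
proof -
  have T1: "real r * (real s - 1) \<le> T"
  proof -
    have "real (r * (s - 1)) \<le> real T" using T_ge by (simp only: of_nat_le_iff)
    then show ?thesis using s_ge_2 by (simp add: of_nat_diff)
  qed
  have "real s \<ge> 2" using s_ge_2 by simp
  note * = missing_weight_bound[OF rho x_a_nonneg x_a_bounds(1,2) T_le this T1 _ D_le_num E_nonneg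
      D_ge_if_degree_ge[OF d_ge_rho] D_ge_if_degree_ge[OF d_ge_n] sn_ge]
  show "T < 95/100 + 755/1000 * s" by (rule *) simp_all
  have "real r < n" by (rule *) simp_all
  then show "r < n" by simp
qed

text \<open>As \<open>r < n\<close>, some \<open>j\<close> in \<open>A\<close> is adjacent to
  \<open>u\<close> and to all of \<open>W\<close>; its equation gives
  \<open>s - E \<le> \<rho>\<close>, and \<open>E\<close> is at most 1/10.\<close>

lemma s_le: "s \<le> \<rho> + 1/10"
proof -
  obtain j where j: "j \<in> A" "j \<notin> J"
    using r_less_n card_mono[OF finite_J, of A] unfolding r_def n_def by fastforce
  then have "miss j = {}" by (simp add: J_def)
  have "real s - E = 1 + (\<Sum>w\<in>W. x w)" by (simp add: s_def E_def sum_subtractf)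
  also have "\<dots> \<le> \<rho> * x j" using rho_x_A[OF j(1)] \<open>miss j = {}\<close> x_a_nonneg by simp
  also have "\<dots> \<le> \<rho> * 1" using x_le_1 j A_subset rho by (intro mult_left_mono) auto
  finally have "s - E \<le> \<rho>" by simp
  moreover have "12 * E \<le> (\<rho> - 3) * E" using rho E_nonneg by (intro mult_right_mono) auto
  then have "E \<le> 1/10" using D_ge_if_degree_ge[OF d_ge_rho] D_le_num by simp
  ultimately show ?thesis by simp
qed

end

section \<open>Classification and isomorphisms\<close>

text \<open>The list \<open>zs\<close> names the vertices of \<open>G\<close> in the order of the
  labels of \<open>H\<close>. An injective map that sends edges to edges is onto the edges when both
  graphs have equally many, so only one direction has to be checked.\<close>

lemma graph_iso_nth:
  assumes G: "simple_graph G" and H: "simple_graph H" and card: "card G = card H"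
    and dist: "distinct zs" and verts: "verts H \<subseteq> {..<length zs}"
    and edges: "\<And>e. e \<in> H \<Longrightarrow> (!) zs ` e \<in> G"
  shows "graph_iso G H"
proof -
  let ?f = "(!) zs"
  have inj: "inj_on ?f (verts H)" using inj_on_nth[OF dist] verts by auto
  have "inj_on ((`) ?f) H" using inj unfolding verts_def by (rule inj_on_image)
  then have "card ((`) ?f ` H) = card G" using card by (simp add: card_image)
  moreover have "(`) ?f ` H \<subseteq> G" using edges by blast
  moreover have "finite G" using G by (simp add: simple_graph_def)
  ultimately have im: "(`) ?f ` H = G" by (simp add: card_subset_eq)
  have vG: "?f ` verts H = verts G" unfolding im[symmetric] verts_def by blast
  define g where "g = inv_into (verts H) ?f"
  have "bij_betw ?f (verts H) (verts G)" using inj vG by (simp add: bij_betw_def)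
  then have bij: "bij_betw g (verts G) (verts H)" unfolding g_def by (rule bij_betw_inv_into)
  have "g ` ?f ` e = e" if "e \<in> H" for e
    unfolding g_def using inj that by (intro inv_into_image_cancel) (auto simp: verts_def)
  then have "(\<lambda>e. g ` e) ` G = H" unfolding im[symmetric] image_image by simp
  with bij show ?thesis unfolding graph_iso_def by blast
qed

lemma card_Y_graph: "m = 3 * k + 3 \<Longrightarrow> card (Y_graph m) = m"
  using sum_edges_Y_graph[of m k "\<lambda>_. 1"] by simp

lemma card_T_graph: "m = 3 * k + 4 \<Longrightarrow> card (T_graph m) = m"
  using sum_edges_T_graph[of m k "\<lambda>_. 1"] by simp

lemma card_L_graph: "m = 2 * k + 6 \<Longrightarrow> card (L_graph m) = m"
  using sum_edges_L_graph[of m k "\<lambda>_. 1"] by simp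

section \<open>Reduction to the three extremal shapes\<close>

context near_extremal
begin

text \<open>Each vertex of \<open>J\<close> contributes at least \<open>s - 1\<close> to
  \<open>T\<close>, and \<open>T_upper\<close> leaves room for two of them only at
  \<open>s = 2\<close>.\<close>

lemma r_cases:
  shows "s = 2 \<Longrightarrow> r \<le> 2" and "s \<ge> 3 \<Longrightarrow> r = 1"
proof -
  have T1: "real r * (real s - 1) \<le> T"
  proof -
    have "real (r * (s - 1)) \<le> real T" using T_ge by (simp only: of_nat_le_iff)
    then show ?thesis using s_ge_2 by (simp add: of_nat_diff)
  qed
  show "r \<le> 2" if "s = 2"
    using T1 T_upper that by simp
  show "r = 1" if "s \<ge> 3"
  proof (rule ccontr)
    assume "r \<noteq> 1"
    then have "2 \<le> real r" using r_pos by simp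
    then have "2 * (real s - 1) \<le> real r * (real s - 1)" using that by (intro mult_right_mono) auto
    then show False using T1 T_upper that by simp
  qed
qed

lemma J_eq: "r = 1 \<Longrightarrow> J = {v}"
  using v_in_J by (auto simp: r_def card_1_singleton_iff)

lemma sum_k_if_J: "J = {v} \<Longrightarrow> (\<Sum>j\<in>A. k j) = k v" and T_if_J: "J = {v} \<Longrightarrow> T = k v * (s - k v)"
  using sum_over_J[of "\<lambda>_. 1"] sum_over_J[of "\<lambda>j. s - k j"] by (simp_all add: T_def)

lemma s_less_5: "s < 5"
proof (rule ccontr)
  assume "\<not> s < 5"
  then have s5: "s \<ge> 5" by simp
  then have r1: "r = 1" using r_cases(2) by simp
  have "12 * E \<le> (\<rho> - 3) * E" using rho E_nonneg by (intro mult_right_mono) auto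
  then have "E \<le> 1" using D_ge_if_degree_ge[OF d_ge_rho] D_le_num by simp
  have "real s - 1 \<le> T" using T_ge r1 s5 by simp
  then have "(real s - 1) * (1 - E) \<le> T * (1 - E)" using \<open>E \<le> 1\<close> by (intro mult_right_mono) auto
  then have T: "(real s - 1) * (1 - E) \<le> \<rho> * (\<rho> * E + x a)" using T_le by simp
  have E: "(real n - 1) * E \<le> D" using D_ge_if_degree_ge[OF d_ge_n] r1 by simp
  show False
    using no_large_side[OF rho x_a_bounds(3,1) T _ s_le D_le E sn_ge] s5 by simp
qed

text \<open>Parity settles what the estimates leave open: \<open>s = 2\<close> with one missing
  edge, and \<open>s = 4\<close> with \<open>k v\<close> equal to 1 or 3, both make
  \<open>card G\<close> odd. At \<open>s = 4\<close> the value \<open>k v = 2\<close> would give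
  \<open>T = 4\<close>, which \<open>T_upper\<close> forbids.\<close>

lemma classification:
  assumes even: "even (card G)"
  shows "s = 3 \<and> J = {v} \<or> s = 2 \<and> r = 2"
proof -
  consider "s = 2" | "s = 3" | "s = 4" using s_ge_2 s_less_5 by linarith
  then show ?thesis
  proof cases
    case 1
    then have k1: "k j = 1" if "j \<in> J" for j
      using that k_pos_iff[of j] k_le[of j] by (auto simp: J_def)
    have "(\<Sum>j\<in>A. k j) = (\<Sum>j\<in>J. k j * 1)" using sum_over_J[of "\<lambda>_. 1"] by simp
    also have "\<dots> = r" using k1 by (simp add: r_def)
    finally have "card G + r = 2 * n + 2" using card_G_eq 1 by simp
    then have "even r" using even by presburger
    then have "r = 2" using r_cases(1)[OF 1] r_pos by (cases "r = 1") auto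
    with 1 show ?thesis by simp
  next
    case 2
    then show ?thesis using r_cases(2) J_eq by simp
  next
    case 3
    then have J: "J = {v}" using r_cases(2) J_eq by simp
    have "T < 4" using T_upper 3 by simp
    moreover have "T = k v * (4 - k v)" using T_if_J[OF J] 3 by simp
    ultimately have "k v \<noteq> 2" by auto
    moreover have "k v < 4" "1 \<le> k v" using k_le[of v] 3 k_pos_iff[OF v_in_A] v_in_J by auto
    ultimately have "k v = 1 \<or> k v = 3" by linarith
    moreover have "card G + k v = 4 * n + 2" using card_G_eq sum_k_if_J[OF J] 3 by simp
    ultimately have False using even by presburger
    then show ?thesis ..
  qed
qed

lemma adj_u: "j \<in> A \<Longrightarrow> {j,u} \<in> G" and adj_va: "{v,a} \<in> G"
  using v_adj_a by (auto simp: A_def nbrs_def)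

lemma adj_W: "j \<in> A \<Longrightarrow> w \<in> W \<Longrightarrow> w \<notin> miss j \<Longrightarrow> {j,w} \<in> G"
  by (auto simp: miss_def nbrs_def insert_commute)

lemma miss_empty: "j \<in> A \<Longrightarrow> j \<notin> J \<Longrightarrow> miss j = {}"
  by (auto simp: J_def)

lemma W_not_A: "w \<in> W \<Longrightarrow> w \<notin> A \<and> w \<noteq> u \<and> w \<noteq> a"
  using A_Int_B u_notin_B by (auto simp: W_def)

lemma u_neq_a: "u \<noteq> a" and a_notin_A: "a \<notin> A"
  using a_in_B u_notin_B A_Int_B by auto

text \<open>If \<open>v\<close> misses only \<open>b\<close>, then \<open>u\<close> and
  \<open>c\<close> form the class of size 2 in \<open>T_graph\<close>; if it misses \<open>b\<close>
  and \<open>c\<close>, then \<open>c\<close> is the added vertex of \<open>Y_graph\<close>. In both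
  cases \<open>A - {v}\<close> is the large independent class.\<close>

lemma three_case:
  assumes s3: "s = 3" and J: "J = {v}"
  shows "(\<exists>q. card G = 3 * q + 3 \<and> graph_iso G (Y_graph (card G)))
    \<or> (\<exists>q. card G = 3 * q + 4 \<and> graph_iso G (T_graph (card G)))"
proof -
  have "card W = 2" using s3 by (simp add: s_def)
  then have "card (W - {b}) = 1" using b_in_W by simp
  then obtain c where Wb: "W - {b} = {c}" by (rule card_1_singletonE)
  then have W: "W = {b,c}" "c \<noteq> b" using insert_Diff[OF b_in_W] by auto
  then have c: "c \<in> W" by simp
  obtain ys where ys: "set ys = A - {v}" "distinct ys"
    using finite_distinct_list[of "A - {v}"] finite_A by auto
  have "length ys = card (A - {v})" using distinct_card[OF ys(2)] ys(1) by simp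
  also have "\<dots> = n - 1" using v_in_A by (simp add: n_def)
  finally have len: "length ys = n - 1" .
  have n2: "n \<ge> 2" using r_less_n r_pos by linarith
  have full: "{j,u} \<in> G" "{j,b} \<in> G" "{j,c} \<in> G" if "j \<in> set ys" for j
  proof -
    have "j \<in> A" "j \<notin> J" using that ys(1) J by simp_all
    then have "miss j = {}" by (rule miss_empty)
    then show "{j,u} \<in> G" "{j,b} \<in> G" "{j,c} \<in> G"
      using adj_u adj_W[OF _ b_in_W] adj_W[OF _ c] \<open>j \<in> A\<close> by simp_all
  qed
  have m: "card G + k v = 3 * n + 2" using card_G_eq sum_k_if_J[OF J] s3 by simp
  have "1 \<le> k v" "k v < 3" using k_le[of v] s3 k_pos_iff[OF v_in_A] v_in_J by auto
  then consider "k v = 1" | "k v = 2" by linarith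
  then show ?thesis
  proof cases
    case 1
    have "miss v = {b}" using 1 b_in_miss_v by (auto simp: k_def card_1_singleton_iff)
    then have vc: "{v,c} \<in> G" using adj_W[OF v_in_A c] W by simp
    have m': "card G = 3 * (n - 1) + 4" using m 1 n2 by simp
    define zs where "zs = [v,a,b,u,c] @ ys"
    have z: "zs ! 0 = v" "zs ! 1 = a" "zs ! 2 = b" "zs ! 3 = u" "zs ! 4 = c" by (simp_all add: zs_def)
    have zi: "zs ! i \<in> set ys" if "i \<in> {5..<5 + (n - 1)}" for i
      using that len by (auto simp: zs_def nth_append)
    have "graph_iso G (T_graph (card G))"
    proof (rule graph_iso_nth[OF simple simple_T_graph[OF m'], of zs])
      show "card G = card (T_graph (card G))" using card_T_graph[OF m'] by simp
      show "distinct zs"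
        using ys v_in_A c b_in_W W_not_A u_notin_A u_neq_a a_notin_A W(2) by (auto simp: zs_def)
      show "verts (T_graph (card G)) \<subseteq> {..<length zs}"
        unfolding verts_T_graph[OF m'] using len by (auto simp: zs_def)
      fix e assume "e \<in> T_graph (card G)"
      then consider "e \<in> {{3,0},{4,0},{0,1},{1,2}}" | i where "i \<in> {5..<5 + (n - 1)}" "e \<in> {{i,2},{i,3},{i,4}}"
        unfolding T_graph_eq[OF m'] by blast
      then show "(!) zs ` e \<in> G"
      proof cases
        case 1
        moreover have "{u,v} \<in> G" "{c,v} \<in> G" "{v,a} \<in> G" "{a,b} \<in> G"
          using adj_u[OF v_in_A] vc adj_va edge_ab by (simp_all add: insert_commute)
        ultimately show ?thesis using z by auto
      next
        case 2
        then show ?thesis using full[OF zi[OF 2(1)]] z by auto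
      qed
    qed
    with m' show ?thesis by blast
  next
    case 2
    have m': "card G = 3 * (n - 1) + 3" using m 2 n2 by simp
    define zs where "zs = [u,v,a,b,c] @ ys"
    have z: "zs ! 0 = u" "zs ! 1 = v" "zs ! 2 = a" "zs ! 3 = b" "zs ! 4 = c" by (simp_all add: zs_def)
    have zi: "zs ! i \<in> set ys" if "i \<in> {5..<5 + (n - 1)}" for i
      using that len by (auto simp: zs_def nth_append)
    have "graph_iso G (Y_graph (card G))"
    proof (rule graph_iso_nth[OF simple simple_Y_graph[OF m'], of zs])
      show "card G = card (Y_graph (card G))" using card_Y_graph[OF m'] by simp
      show "distinct zs"
        using ys v_in_A c b_in_W W_not_A u_notin_A u_neq_a a_notin_A W(2) by (auto simp: zs_def)
      have "1 \<le> n - 1" using n2 by simp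
      show "verts (Y_graph (card G)) \<subseteq> {..<length zs}"
        unfolding verts_Y_graph[OF m' \<open>1 \<le> n - 1\<close>] using len by (auto simp: zs_def)
      fix e assume "e \<in> Y_graph (card G)"
      then consider "e \<in> {{0,1},{1,2},{2,3}}" | i where "i \<in> {5..<5 + (n - 1)}" "e \<in> {{i,0},{i,3},{i,4}}"
        unfolding Y_graph_eq[OF m'] by blast
      then show "(!) zs ` e \<in> G"
      proof cases
        case 1
        moreover have "{u,v} \<in> G" "{v,a} \<in> G" "{a,b} \<in> G"
          using adj_u[OF v_in_A] adj_va edge_ab by (simp_all add: insert_commute)
        ultimately show ?thesis using z by auto
      next
        case 2
        then show ?thesis using full[OF zi[OF 2(1)]] z by auto
      qed
    qed
    with m' show ?thesis by blast
  qed
qed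

text \<open>Both vertices of \<open>J\<close> miss \<open>b\<close>, the only vertex of
  \<open>W\<close>, so \<open>v'\<close> is adjacent to \<open>u\<close> alone and becomes the
  pendant vertex. Any \<open>h\<close> in \<open>A\<close> outside \<open>J\<close> closes the
  5-cycle through \<open>u\<close>, \<open>h\<close>, \<open>b\<close>, \<open>a\<close>,
  \<open>v\<close>.\<close>

lemma two_case:
  assumes s2: "s = 2" and r2: "r = 2"
  shows "graph_iso G (L_graph (card G)) \<and> card G - \<rho>^2 > 7/3"
proof -
  have "card W = 1" using s2 by (simp add: s_def)
  then have W: "W = {b}" using b_in_W by (auto simp: card_1_singleton_iff)
  have "card (J - {v}) = 1" using v_in_J r2 by (simp add: r_def)
  then obtain v' where Jv: "J - {v} = {v'}" by (rule card_1_singletonE)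
  then have J: "J = {v,v'}" "v' \<noteq> v" using insert_Diff[OF v_in_J] by auto
  have v': "v' \<in> A" using J(1) by (auto simp: J_def)
  have k1: "k j = 1" if "j \<in> J" for j
    using that k_pos_iff[of j] k_le[of j] s2 by (auto simp: J_def)
  have "(\<Sum>j\<in>A. k j) = (\<Sum>j\<in>J. k j * 1)" using sum_over_J[of "\<lambda>_. 1"] by simp
  also have "\<dots> = 2" using k1 r2 by (simp add: r_def)
  finally have m: "card G = 2 * n" using card_G_eq s2 by simp
  have n3: "n \<ge> 3" using r_less_n r2 by simp
  have m': "card G = 2 * (n - 3) + 6" using m n3 by simp
  have "card G - \<rho>^2 > 7/3"
  proof (rule ccontr)
    assume "\<not> card G - \<rho>^2 > 7/3"
    then have D: "D \<le> 1/3 + x a" by (simp add: D_def)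
    have "12 * E \<le> (\<rho> - 3) * E" using rho E_nonneg by (intro mult_right_mono) auto
    then have "E \<le> 1" using D_ge_if_degree_ge[OF d_ge_rho] D_le_num by simp
    have "2 \<le> T" using T_ge r2 s2 by simp
    then have "2 * (1 - E) \<le> T * (1 - E)" using \<open>E \<le> 1\<close> by (intro mult_right_mono) auto
    then have T: "2 * (1 - E) \<le> \<rho> * (\<rho> * E + x a)" using T_le by simp
    have E: "(real n - 2) * E \<le> D" using D_ge_if_degree_ge[OF d_ge_n] r2 by simp
    have "0 \<le> (\<Sum>w\<in>B. d w * (1 - x w))" using cost_nonneg by (intro sum_nonneg) auto
    then have "\<rho>^2 \<le> card G" using deficiency by simp
    then have n: "\<rho>^2 \<le> 2 * real n" using m by simp
    have X: "x a * (\<rho>^2 - 1) \<le> \<rho> + 1" using x_a_bounds(3) s2 by simp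
    show False by (rule no_pendant_type[OF rho X T D E n])
  qed
  moreover have "graph_iso G (L_graph (card G))"
  proof -
    obtain ys' where ys': "set ys' = A - {v,v'}" "distinct ys'"
      using finite_distinct_list[of "A - {v,v'}"] finite_A by auto
    have "length ys' = card (A - {v,v'})" using distinct_card[OF ys'(2)] ys'(1) by simp
    also have "\<dots> = n - 2" using v_in_A v' J(2) by (simp add: n_def card_Diff_subset)
    finally have "length ys' = Suc (n - 3)" using n3 by simp
    then obtain h ys where h: "ys' = h # ys" "length ys = n - 3" by (auto simp: length_Suc_conv)
    have full: "{j,u} \<in> G" "{j,b} \<in> G" if "j \<in> set ys'" for j
    proof -
      have "j \<in> A" "j \<notin> J" using that ys'(1) J(1) by simp_all
      then have "miss j = {}" by (rule miss_empty)
      then show "{j,u} \<in> G" "{j,b} \<in> G"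
        using adj_u adj_W[OF _ b_in_W] \<open>j \<in> A\<close> by simp_all
    qed
    define zs where "zs = [u,h,b,a,v,v'] @ ys"
    have z: "zs ! 0 = u" "zs ! 1 = h" "zs ! 2 = b" "zs ! 3 = a" "zs ! 4 = v" "zs ! 5 = v'"
      by (simp_all add: zs_def)
    have zi: "zs ! i \<in> set ys'" if "i \<in> {6..<6 + (n - 3)}" for i
      using that h by (auto simp: zs_def nth_append)
    have hA: "h \<in> A" "h \<noteq> v" "h \<noteq> v'" "h \<in> set ys'" using ys'(1) h by auto
    show ?thesis
    proof (rule graph_iso_nth[OF simple simple_L_graph[OF m'], of zs])
      show "card G = card (L_graph (card G))" using card_L_graph[OF m'] by simp
      have "set ys = A - {v,v'} - {h}" "distinct ys" using ys' h(1) by auto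
      then show "distinct zs"
        using hA v_in_A v' J(2) b_in_W W_not_A u_notin_A u_neq_a a_notin_A by (auto simp: zs_def)
      show "verts (L_graph (card G)) \<subseteq> {..<length zs}"
        unfolding verts_L_graph[OF m'] using h(2) by (auto simp: zs_def)
      fix e assume "e \<in> L_graph (card G)"
      then have "e \<in> {{0,1},{1,2},{2,3},{3,4},{4,0},{0,5}} \<or> (\<exists>i\<in>{6..<6 + (n - 3)}. e \<in> {{i,0},{i,2}})"
        unfolding L_graph_eq[OF m'] by (simp only: Un_iff UN_iff)
      then show "(!) zs ` e \<in> G"
      proof (elim disjE bexE)
        assume "e \<in> {{0,1},{1,2},{2,3},{3,4},{4,0},{0,5}}"
        moreover have "{u,h} \<in> G" "{h,b} \<in> G" "{b,a} \<in> G" "{a,v} \<in> G" "{v,u} \<in> G" "{u,v'} \<in> G"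
          using full[OF hA(4)] adj_u[OF v_in_A] adj_u[OF v'] adj_va edge_ab by (simp_all add: insert_commute)
        ultimately show ?thesis using z by auto
      next
        fix i assume i: "i \<in> {6..<6 + (n - 3)}" "e \<in> {{i,0},{i,2}}"
        then show ?thesis using full[OF zi[OF i(1)]] z by auto
      qed
    qed
  qed
  ultimately show ?thesis by simp
qed

end

text \<open>The third alternative carries its deficiency bound so that it can be discarded when
  \<open>G\<close> is compared with \<open>Y_graph\<close> or \<open>T_graph\<close>.\<close>

lemma extremal_cases:
  fixes G :: "'a set set"
  assumes G: "simple_graph G" "triangle_free G" "\<not> bipartite G" "even (card G)"
    and rho: "spec_rad G \<ge> 159/10" and cost: "card G - (spec_rad G)^2 \<le> 5/2 - 1 / (spec_rad G - 1)"
  shows "(\<exists>q. card G = 3 * q + 3 \<and> graph_iso G (Y_graph (card G)))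
    \<or> (\<exists>q. card G = 3 * q + 4 \<and> graph_iso G (T_graph (card G)))
    \<or> graph_iso G (L_graph (card G)) \<and> card G - (spec_rad G)^2 > 7/3"
proof (rule spec_rad_perron[OF G(1)])
  show "G \<noteq> {}" using G(3) unfolding bipartite_def by blast
next
  fix y
  assume y: "\<And>v. v \<in> verts G \<Longrightarrow> 0 \<le> y v" "\<exists>v\<in>verts G. y v \<noteq> 0"
    "\<And>v. v \<in> verts G \<Longrightarrow> (\<Sum>w\<in>nbrs G v. y w) = spec_rad G * y v"
  have fin: "finite (verts G)" "verts G \<noteq> {}" using finite_verts[OF G(1)] y(2) by auto
  have "Max (y ` verts G) \<in> y ` verts G" using fin by (intro Max_in) auto
  then obtain u where u': "u \<in> verts G" "y u = Max (y ` verts G)" by auto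
  have u: "y v \<le> y u" if "v \<in> verts G" for v
    using u' that fin by simp
  obtain v where "v \<in> verts G" "y v \<noteq> 0" using y(2) by blast
  then have "y u > 0" using y(1)[of v] u[of v] by linarith
  define x where "x v = y v / y u" for v
  interpret perron_vertex G x "spec_rad G" u
  proof
    show "(\<Sum>w\<in>nbrs G v. x w) = spec_rad G * x v" if "v \<in> verts G" for v
      using y(3)[OF that] by (simp add: x_def sum_divide_distrib[symmetric])
  qed (use G(1,2) u u'(1) y(1) \<open>y u > 0\<close> in \<open>auto simp: x_def\<close>)
  have "1 / (spec_rad G - 1) \<ge> 0" using rho by simp
  then have "card G - (spec_rad G)^2 \<le> 5/2" using cost by linarith
  then obtain a b v where abv: "EB = {{a,b}}" "a \<in> B" "b \<in> B" "a \<noteq> b"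
    "nbrs G a \<inter> A = {v}" "nbrs G b \<inter> A \<noteq> {}"
    by (rule one_edge_in_B[OF G(3) rho])
  interpret near_extremal G x "spec_rad G" u a b v
    by unfold_locales (use abv rho cost in auto)
  from classification[OF G(4)] show ?thesis
  proof (elim disjE conjE)
    assume "s = 3" "J = {v}"
    from three_case[OF this] show ?thesis by blast
  next
    assume "s = 2" "r = 2"
    from two_case[OF this] show ?thesis by blast
  qed
qed

text \<open>Only a graph whose radius is at least that of \<open>H\<close> has to be identified;
  this single implication yields both the inequality and the equality case.\<close>

lemma extremal_if_iso:
  assumes "simple_graph G" "simple_graph H"
    and "spec_rad H \<le> spec_rad G \<Longrightarrow> graph_iso G H"
  shows "spec_rad G \<le> spec_rad H \<and> (spec_rad G = spec_rad H \<longleftrightarrow> graph_iso G H)"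
  using assms(3) spec_rad_iso[OF _ assms(1,2)] by (cases "spec_rad H \<le> spec_rad G") auto

theorem theorem1p7:
  fixes G :: "'a set set" and m :: nat
  assumes "even m" and "m \<ge> 258"
    and "simple_graph G" and "triangle_free G" and "\<not> bipartite G" and "card G = m"
  shows "(\<forall>t::nat. t > 0 \<and> m = 3*t \<longrightarrow>
            spec_rad G \<le> spec_rad (Y_graph m) \<and>
            (spec_rad G = spec_rad (Y_graph m) \<longleftrightarrow> graph_iso G (Y_graph m)))
       \<and> (\<forall>t::nat. t > 0 \<and> m = 3*t + 1 \<longrightarrow>
            spec_rad G \<le> spec_rad (T_graph m) \<and>
            (spec_rad G = spec_rad (T_graph m) \<longleftrightarrow> graph_iso G (T_graph m)))
       \<and> (\<forall>t::nat. t > 0 \<and> m = 3*t + 2 \<longrightarrow>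
            spec_rad G \<le> spec_rad (L_graph m) \<and>
            (spec_rad G = spec_rad (L_graph m) \<longleftrightarrow> graph_iso G (L_graph m)))"
proof -
  let ?\<rho> = "spec_rad G"
  have m258: "real m \<ge> 258" using assms(2) by simp
  have rho_ge: "159/10 \<le> ?\<rho>" if "sqrt (real m - 5/2) \<le> ?\<rho>"
  proof -
    \<comment> \<open>Here \<open>15.9^2 = 252.81\<close>, while \<open>m \<ge> 258\<close> gives
      \<open>m - 5/2 \<ge> 255.5\<close>.\<close>
    have "159/10 \<le> sqrt (real m - 5/2)" using m258 by (intro real_le_rsqrt) (simp add: power2_eq_square)
    then show ?thesis using that by simp
  qed
  note cases = extremal_cases[OF assms(3-5), unfolded assms(6), OF assms(1)]
  have cases73: "(\<exists>q. m = 3 * q + 3 \<and> graph_iso G (Y_graph m)) \<or> (\<exists>q. m = 3 * q + 4 \<and> graph_iso G (T_graph m))"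
    if le: "sqrt (real m - 7/3) \<le> ?\<rho>"
  proof -
    have "sqrt (real m - 5/2) \<le> sqrt (real m - 7/3)" by (intro real_sqrt_le_mono) simp
    then have rho: "159/10 \<le> ?\<rho>" using rho_ge le by linarith
    have sq: "real m - 7/3 \<le> ?\<rho>^2" by (rule sqrt_le_D[OF le])
    \<comment> \<open>As \<open>5/2 - 7/3 = 1/6\<close>, this turns the deficiency bound 7/3 into
      the one required by \<open>extremal_cases\<close>.\<close>
    have "1 / (?\<rho> - 1) \<le> 1 / 6" using rho by (intro divide_left_mono) auto
    then have "real m - ?\<rho>^2 \<le> 5/2 - 1 / (?\<rho> - 1)" using sq by linarith
    moreover have "\<not> 7/3 < real m - ?\<rho>^2" using sq by linarith
    ultimately show ?thesis using cases[OF rho] by blast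
  qed
  have Y_case: "spec_rad G \<le> spec_rad (Y_graph m) \<and>
      (spec_rad G = spec_rad (Y_graph m) \<longleftrightarrow> graph_iso G (Y_graph m))" if t: "t > 0" "m = 3 * t" for t
  proof (rule extremal_if_iso[OF assms(3)])
    have m: "m = 3 * (t - 1) + 3" and k: "t - 1 \<ge> 1" using t assms(2) by auto
    show "simple_graph (Y_graph m)" by (rule simple_Y_graph[OF m])
    assume "spec_rad (Y_graph m) \<le> ?\<rho>"
    then have "sqrt (real m - 7/3) \<le> ?\<rho>" using spec_rad_Y_graph_ge[OF m k] by linarith
    moreover have "m \<noteq> 3 * q + 4" for q using t by presburger
    ultimately show "graph_iso G (Y_graph m)" using cases73 by blast
  qed
  have T_case: "spec_rad G \<le> spec_rad (T_graph m) \<and>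
      (spec_rad G = spec_rad (T_graph m) \<longleftrightarrow> graph_iso G (T_graph m))" if t: "t > 0" "m = 3 * t + 1" for t
  proof (rule extremal_if_iso[OF assms(3)])
    have m: "m = 3 * (t - 1) + 4" using t by auto
    show "simple_graph (T_graph m)" by (rule simple_T_graph[OF m])
    assume "spec_rad (T_graph m) \<le> ?\<rho>"
    then have "sqrt (real m - 7/3) \<le> ?\<rho>" using spec_rad_T_graph_ge[OF m] by linarith
    moreover have "m \<noteq> 3 * q + 3" for q using t by presburger
    ultimately show "graph_iso G (T_graph m)" using cases73 by blast
  qed
  have L_case: "spec_rad G \<le> spec_rad (L_graph m) \<and>
      (spec_rad G = spec_rad (L_graph m) \<longleftrightarrow> graph_iso G (L_graph m))" if t: "t > 0" "m = 3 * t + 2" for t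
  proof (rule extremal_if_iso[OF assms(3)])
    have m: "m = 2 * ((m - 6) div 2) + 6" using assms(1,2) by presburger
    show "simple_graph (L_graph m)" by (rule simple_L_graph[OF m])
    assume le: "spec_rad (L_graph m) \<le> ?\<rho>"
    note L = spec_rad_L_graph_ge[OF m]
    have rho: "159/10 \<le> ?\<rho>" using rho_ge L(1) le by linarith
    have "sqrt (real m - 5/2) \<ge> 15" using m258 by (intro real_le_rsqrt) (simp add: power2_eq_square)
    then have L15: "spec_rad (L_graph m) \<ge> 15" using L(1) by linarith
    \<comment> \<open>Passing from \<open>L_graph m\<close> to \<open>G\<close> raises the radius or
      keeps it, so neither \<open>m - ?\<rho>^2\<close> nor \<open>1 / (?\<rho> - 1)\<close> grows;
      the implicit bound for \<open>L_graph m\<close> therefore carries over to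
      \<open>G\<close>.\<close>
    have "1 / (?\<rho> - 1) \<le> 1 / (spec_rad (L_graph m) - 1)" using le L15 by (intro divide_left_mono) auto
    moreover have "(spec_rad (L_graph m))^2 \<le> ?\<rho>^2" using le L15 by (intro power_mono) auto
    ultimately have "real m - ?\<rho>^2 \<le> 5/2 - 1 / (?\<rho> - 1)" using L(2) by linarith
    moreover have "m \<noteq> 3 * q + 3" "m \<noteq> 3 * q + 4" for q using t by presburger+
    ultimately show "graph_iso G (L_graph m)" using cases[OF rho] by blast
  qed
  show ?thesis using Y_case T_case L_case by blast
qed

end
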